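(* Assume $C=I_{n_x}$ (full-state measurement, so $n_y=n_x$). Then for $K\in\mathcal{K}$, $$0\in\partial J(K)\iff K\in\operatorname*{arg\,min}_{K\in\mathcal{K}}J(K),$$ where $\partial J$ is the Fréchet subdifferential of $J$.
   Context: Fix $A\in\mathbb{R}^{n_x\times n_x}$, $B\in\mathbb{R}^{n_x\times n_u}$, $B_w\in\mathbb{R}^{n_x\times n_w}$, $C\in\mathbb{R}^{n_y\times n_x}$ and symmetric matrices $Q\in\mathbb{R}^{n_x\times n_x}$, $R\in\mathbb{R}^{n_u\times n_u}$. Standing assumptions: $(A,B)$ is stabilizable; $B_w$ and $C$ have full row rank; $Q$ and $R$ are positive definite; and $\mathcal{K}:=\{K\in\mathbb{R}^{n_u\times n_y}\mid \text{all eigenvalues of } A+BKC \text{ have modulus}<1\}$ is nonempty. For $K\in\mathcal{K}$ and $\omega\in[0,2\pi]$ let $$\mathbf{T}_{zw}(K,\omega)=\begin{bmatrix}Q^{1/2}\\ R^{1/2}KC\end{bmatrix}\left(e^{j\omega}I-(A+BKC)\right)^{-1}B_w,\qquad J(K):=\max_{\omega\in[0,2\pi]}\sigma_{\max}(\mathbf{T}_{zw}(K,\omega)),$$ where $j$ is the imaginary unit and $\sigma_{\max}$ the largest singular value. The Fréchet subdifferential of a locally Lipschitz function $f$ on an open set at $\bar x$ is $\partial f(\bar x)=\{v\mid\liminf_{y\to\bar x,\,y\ne\bar x}\frac{f(y)-f(\bar x)-\langle v,y-\bar x\rangle}{\|y-\bar x\|}\ge 0\}$ (trace inner product and Frobenius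 norm on matrices). *)

theory Defs
  imports "HOL-Analysis.Analysis"
begin

text \<open>
  \<^typ>\<open>real ^ 'n ^ 'm\<close> is the type of real matrices with \<^typ>\<open>'m\<close>-indexed rows and
  \<^typ>\<open>'n\<close>-indexed columns. Its inner product and norm in the library are the trace inner
  product and the Frobenius norm.
\<close>

definition complex_matrix :: "real ^ 'n ^ 'm \<Rightarrow> complex ^ 'n ^ 'm"
  where "complex_matrix M = (\<chi> i j. complex_of_real (M $ i $ j))"

definition conj_transpose :: "complex ^ 'n ^ 'm \<Rightarrow> complex ^ 'm ^ 'n"
  where "conj_transpose M = (\<chi> i j. cnj (M $ j $ i))"

definition stack_rows :: "'a ^ 'n ^ 'm \<Rightarrow> 'a ^ 'n ^ 'k \<Rightarrow> 'a ^ 'n ^ ('m + 'k)"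
  where "stack_rows M N = (\<chi> i. case i of Inl a \<Rightarrow> M $ a | Inr b \<Rightarrow> N $ b)"

definition is_eigenvalue :: "'a::field ^ 'n ^ 'n \<Rightarrow> 'a \<Rightarrow> bool"
  where "is_eigenvalue M l \<longleftrightarrow> (\<exists>v. v \<noteq> 0 \<and> M *v v = l *s v)"

text \<open>Eigenvalues of a real matrix are taken over the complex numbers.\<close>

definition schur_stable :: "real ^ 'n ^ 'n \<Rightarrow> bool"
  where "schur_stable M \<longleftrightarrow> (\<forall>l. is_eigenvalue (complex_matrix M) l \<longrightarrow> cmod l < 1)"

definition stabilizable :: "real ^ 'x ^ 'x \<Rightarrow> real ^ 'u ^ 'x \<Rightarrow> bool"
  where "stabilizable A B \<longleftrightarrow> (\<exists>F :: real ^ 'x ^ 'u. schur_stable (A + B ** F))"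

definition full_row_rank :: "real ^ 'n ^ 'm \<Rightarrow> bool"
  where "full_row_rank (M :: real ^ 'n ^ 'm) \<longleftrightarrow> rank M = CARD('m)"

definition symmetric_matrix :: "real ^ 'n ^ 'n \<Rightarrow> bool"
  where "symmetric_matrix M \<longleftrightarrow> transpose M = M"

definition positive_definite :: "real ^ 'n ^ 'n \<Rightarrow> bool"
  where "positive_definite M \<longleftrightarrow> (\<forall>v. v \<noteq> 0 \<longrightarrow> 0 < v \<bullet> (M *v v))"

definition positive_semidefinite :: "real ^ 'n ^ 'n \<Rightarrow> bool"
  where "positive_semidefinite M \<longleftrightarrow> (\<forall>v. 0 \<le> v \<bullet> (M *v v))"

definition matrix_sqrt :: "real ^ 'n ^ 'n \<Rightarrow> real ^ 'n ^ 'n"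
  where "matrix_sqrt M =
    (THE S. symmetric_matrix S \<and> positive_semidefinite S \<and> S ** S = M)"

text \<open>
  The singular values are the nonnegative square roots of the eigenvalues of \<open>M\<^sup>H M\<close>.
  For a wide matrix this includes extra zeros, which do not affect the largest one.
\<close>

definition is_singular_value :: "complex ^ 'n ^ 'm \<Rightarrow> real \<Rightarrow> bool"
  where "is_singular_value M s \<longleftrightarrow>
    0 \<le> s \<and> is_eigenvalue (conj_transpose M ** M) (complex_of_real (s\<^sup>2))"

definition sigma_max :: "complex ^ 'n ^ 'm \<Rightarrow> real"
  where "sigma_max M = (GREATEST s. is_singular_value M s)"

definition stabilizing_gains ::
  "real ^ 'x ^ 'x \<Rightarrow> real ^ 'u ^ 'x \<Rightarrow> real ^ 'x ^ 'y \<Rightarrow> (real ^ 'y ^ 'u) set"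
  where "stabilizing_gains A B C = {K. schur_stable (A + B ** K ** C)}"

definition transfer_zw ::
  "real ^ 'x ^ 'x \<Rightarrow> real ^ 'u ^ 'x \<Rightarrow> real ^ 'w ^ 'x \<Rightarrow> real ^ 'x ^ 'y \<Rightarrow>
   real ^ 'x ^ 'x \<Rightarrow> real ^ 'u ^ 'u \<Rightarrow> real ^ 'y ^ 'u \<Rightarrow> real \<Rightarrow> complex ^ 'w ^ ('x + 'u)"
  where "transfer_zw A B Bw C Q R K \<omega> =
    complex_matrix (stack_rows (matrix_sqrt Q) (matrix_sqrt R ** K ** C))
      ** matrix_inv (mat (exp (\<i> * complex_of_real \<omega>)) - complex_matrix (A + B ** K ** C))
      ** complex_matrix Bw"

text \<open>The maximum below is attained whenever \<open>K\<close> is stabilizing; only such \<open>K\<close> matter.\<close>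

definition hinf_cost ::
  "real ^ 'x ^ 'x \<Rightarrow> real ^ 'u ^ 'x \<Rightarrow> real ^ 'w ^ 'x \<Rightarrow> real ^ 'x ^ 'y \<Rightarrow>
   real ^ 'x ^ 'x \<Rightarrow> real ^ 'u ^ 'u \<Rightarrow> real ^ 'y ^ 'u \<Rightarrow> real"
  where "hinf_cost A B Bw C Q R K =
    (GREATEST m. m \<in> (\<lambda>\<omega>. sigma_max (transfer_zw A B Bw C Q R K \<omega>)) ` {0..2 * pi})"

text \<open>
  \<open>S\<close> is the (open) domain of \<open>f\<close>. The lower limit is taken in the extended reals, and the
  filter \<^term>\<open>at x within S\<close> excludes the point \<open>x\<close> itself.
\<close>

definition frechet_subdifferential :: "'a::real_inner set \<Rightarrow> ('a \<Rightarrow> real) \<Rightarrow> 'a \<Rightarrow> 'a set"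
  where "frechet_subdifferential S f x =
    {v. 0 \<le> Liminf (at x within S) (\<lambda>y. ereal ((f y - f x - v \<bullet> (y - x)) / norm (y - x)))}"

end

theory Submission
  imports Defs "HOL-Computational_Algebra.Fundamental_Theorem_Algebra"
begin

text \<open>
  Write \<open>J\<close> for the cost. If \<open>K\<close> is a global minimizer, every difference quotient at \<open>K\<close>
  is nonnegative and \<open>0\<close> is a subgradient. The content is the converse: no stabilizing gain other
  than a global minimizer has \<open>0\<close> as a Frechet subgradient, although neither the set of stabilizing
  gains nor the cost has to be convex.

  The reason is that the problem is convex in other coordinates. With \<open>F = A + B K\<close>, a bound
  \<open>\<gamma>\<close> on the cost is equivalent to the existence of a quadratic storage function
  \<open>x\<^sup>T P x\<close>, \<open>P\<close> positive definite, that decreases along trajectories up to the supplied energy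
  \<open>\<gamma>\<^sup>2 |w|\<^sup>2 - |z|\<^sup>2\<close> (\<open>dissipative\<close>). In the coordinates \<open>X = P\<^sup>-\<^sup>1\<close>, \<open>Y = K X\<close> the
  inequality is jointly convex in \<open>(X, Y, \<gamma>\<^sup>2)\<close> (\<open>lifted_certificate\<close>). If a gain
  \<open>K1\<close> is strictly better than \<open>K\<close>, then the certificates of \<open>K\<close> and \<open>K1\<close> are joined by a segment
  \<open>(X\<^sub>t, Y\<^sub>t)\<close>, along which the squared cost bound decreases linearly. The gains
  \<open>K\<^sub>t = Y\<^sub>t X\<^sub>t\<^sup>-\<^sup>1\<close> stabilize, satisfy \<open>|K\<^sub>t - K| \<le> c t\<close> and have cost at most
  \<open>J K - \<delta> t\<close> with \<open>\<delta> > 0\<close> (\<open>descent_towards_better_gain\<close>). This linear rate of descent contradicts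
  \<open>0\<close> being a subgradient.

  For the curve to start at \<open>K\<close> itself, the certificate of \<open>K\<close> has to exist for \<open>\<gamma> = J K\<close> exactly, and
  not only for every larger \<open>\<gamma>\<close>. The available storage, that is the supremum of the net energy
  \<open>\<Sum> |z|\<^sup>2 - \<gamma>\<^sup>2 |w|\<^sup>2\<close> extracted from the initial state \<open>x\<close>, provides it
  (\<open>storage_certificate\<close>):
  \<^item> It is finite because \<open>Bw\<close> is onto: every state is reached from \<open>0\<close> in one step, and from \<open>0\<close> no
    net energy can be extracted. The latter is the time domain form of \<open>J K \<le> \<gamma>\<close>
    (\<open>zero_state_gain\<close>), proved with the discrete Fourier transform on longer and longer windows.
  \<^item> It is a quadratic form because a supremum of jointly quadratic functions inherits one half
    of the parallelogram law, and homogeneity gives the other half.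
  \<^item> It is positive definite because it is at least \<open>|z|\<^sup>2 \<ge> x\<^sup>T Q x\<close>.
\<close>

section \<open>Self-adjoint operators and the matrix square root\<close>

text \<open>
  Rayleigh quotient argument: at a maximizer \<open>v\<close> of \<open>x \<bullet> f x\<close>
  on the unit sphere of \<open>S\<close>, the form \<open>l |x|\<^sup>2 - x \<bullet> f x\<close>
  is nonnegative and vanishes, so its gradient \<open>l v - f v\<close> is zero. Applied to a
  real symmetric matrix it yields square roots and coercivity constants; applied to the Gram
  matrix of a complex matrix, with \<^typ>\<open>complex ^ 'n\<close> seen as a real Euclidean
  space, it yields the largest singular value.
\<close>

lemma self_adjoint_extremal_eigenvector:
  fixes f :: "'a::euclidean_space \<Rightarrow> 'a"
  assumes lin: "linear f" and adj: "\<And>x y. f x \<bullet> y = x \<bullet> f y"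
    and sub: "subspace S" and inv: "\<And>x. x \<in> S \<Longrightarrow> f x \<in> S" and nz: "S \<noteq> {0}"
  obtains v l where "v \<in> S" "norm v = 1" "f v = l *\<^sub>R v" "\<And>x. x \<in> S \<Longrightarrow> x \<bullet> f x \<le> l * (x \<bullet> x)"
proof -
  interpret linear f by (rule lin)
  obtain x0 where x0: "x0 \<in> S" "x0 \<noteq> 0" using nz sub subspace_0 by blast
  have "compact (sphere 0 1 \<inter> S)"
    using closed_subspace[OF sub] by (intro compact_Int_closed) auto
  moreover have "x0 /\<^sub>R norm x0 \<in> sphere 0 1 \<inter> S"
    using x0 sub by (auto simp: subspace_scale)
  moreover have "continuous_on (sphere 0 1 \<inter> S) (\<lambda>x. x \<bullet> f x)"
    by (intro continuous_intros linear_continuous_on linear_conv_bounded_linear[THEN iffD1] lin)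
  ultimately obtain v where v: "v \<in> sphere 0 1 \<inter> S"
    and vmax: "\<And>x. x \<in> sphere 0 1 \<inter> S \<Longrightarrow> x \<bullet> f x \<le> v \<bullet> f v"
    using continuous_attains_sup[of "sphere 0 1 \<inter> S" "\<lambda>x. x \<bullet> f x"] by blast
  define l where "l = v \<bullet> f v"
  have nv: "norm v = 1" "v \<in> S" and vv: "v \<bullet> v = 1" using v by (auto simp: norm_eq_1)
  have max: "x \<bullet> f x \<le> l * (x \<bullet> x)" if "x \<in> S" for x
  proof (cases "x = 0")
    case False
    have "(x /\<^sub>R norm x) \<bullet> f (x /\<^sub>R norm x) \<le> l"
      unfolding l_def using False that sub by (intro vmax) (auto simp: subspace_scale)
    then have "(x \<bullet> f x) / (norm x)\<^sup>2 \<le> l"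
      by (simp add: scale power2_eq_square field_simps)
    then show ?thesis using False by (simp add: field_simps power2_norm_eq_inner)
  qed simp
  \<comment> \<open>Perturbing \<open>v\<close> in the direction \<open>y\<close> of the gradient has the first order effect \<open>y \<bullet> y\<close>.\<close>
  define y where "y = l *\<^sub>R v - f v"
  have yS: "y \<in> S" unfolding y_def using nv inv sub by (auto intro: subspace_diff subspace_scale)
  define a where "a = l * (y \<bullet> y) - y \<bullet> f y"
  have a: "0 \<le> a" using max[OF yS] by (simp add: a_def)
  have quad: "0 \<le> a * s\<^sup>2 + 2 * s * (y \<bullet> y)" for s
  proof -
    have "v + s *\<^sub>R y \<in> S" using nv yS sub by (auto intro: subspace_add subspace_scale)
    from max[OF this] have "0 \<le> l * ((v + s *\<^sub>R y) \<bullet> (v + s *\<^sub>R y)) - (v + s *\<^sub>R y) \<bullet> f (v + s *\<^sub>R y)"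
      by simp
    also have "\<dots> = (l - v \<bullet> f v) + s * (2 * l * (v \<bullet> y) - v \<bullet> f y - y \<bullet> f v) + s\<^sup>2 * a"
      using vv by (simp add: a_def add scale inner_add_left inner_add_right algebra_simps
          power2_eq_square inner_commute)
    also have "v \<bullet> f y = f v \<bullet> y" by (simp add: adj)
    also have "(l - v \<bullet> f v) + s * (2 * l * (v \<bullet> y) - f v \<bullet> y - y \<bullet> f v) + s\<^sup>2 * a
        = a * s\<^sup>2 + 2 * s * (y \<bullet> y)"
      by (simp add: l_def[symmetric]) (simp add: y_def inner_diff_left inner_commute algebra_simps)
    finally show ?thesis .
  qed
  have "y \<bullet> y = 0"
  proof (rule ccontr)
    assume "y \<bullet> y \<noteq> 0"
    then have b: "y \<bullet> y > 0" by simp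
    \<comment> \<open>Near the minimizer \<open>- (y \<bullet> y) / a\<close> of the quadratic; \<open>a + 1\<close> avoids the case \<open>a = 0\<close>.\<close>
    have "a * (- (y \<bullet> y) / (a + 1))\<^sup>2 + 2 * (- (y \<bullet> y) / (a + 1)) * (y \<bullet> y)
      = - ((a + 2) * (y \<bullet> y)\<^sup>2) / (a + 1)\<^sup>2"
      using a by (simp add: divide_simps power2_eq_square) (simp add: algebra_simps)
    also have "\<dots> < 0" using a b by (intro divide_neg_pos) auto
    finally show False using quad[of "- (y \<bullet> y) / (a + 1)"] by simp
  qed
  then have "f v = l *\<^sub>R v" by (simp add: y_def)
  then show thesis using that nv max by blast
qed

text \<open>
  The orthogonal complement of an eigenvector is invariant, which gives an induction on the
  dimension.
\<close>

lemma self_adjoint_orthonormal_eigenbasis: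
  fixes f :: "'a::euclidean_space \<Rightarrow> 'a"
  assumes lin: "linear f" and adj: "\<And>x y. f x \<bullet> y = x \<bullet> f y"
    and "subspace S" and "\<And>x. x \<in> S \<Longrightarrow> f x \<in> S"
  shows "\<exists>B. finite B \<and> pairwise orthogonal B \<and> span B = S
      \<and> (\<forall>b\<in>B. norm b = 1 \<and> (\<exists>l. f b = l *\<^sub>R b))"
  using assms(3,4)
proof (induction "dim S" arbitrary: S rule: less_induct)
  case less
  show ?case
  proof (cases "S = {0}")
    case True
    then show ?thesis by (intro exI[of _ "{}"]) auto
  next
    case False
    obtain v l where v: "v \<in> S" "norm v = 1" "f v = l *\<^sub>R v"
      using self_adjoint_extremal_eigenvector[OF lin adj less.prems(1) less.prems(2) False] by blast
    define T where "T = {x \<in> S. v \<bullet> x = 0}"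
    have vv: "v \<bullet> v = 1" using v by (simp add: norm_eq_1)
    have sT: "subspace T" unfolding T_def
      using less.prems(1) by (auto simp: subspace_def inner_add_right)
    have "f x \<in> T" if "x \<in> T" for x
      using that less.prems(2) adj[of v x] v by (simp add: T_def)
    moreover have "dim T < dim S"
    proof (rule dim_psubset)
      have "v \<notin> T" using vv by (simp add: T_def)
      then have "T \<subset> S" using v(1) T_def by blast
      then show "span T \<subset> span S"
        using sT less.prems(1) by (simp add: span_eq_iff[THEN iffD2])
    qed
    ultimately obtain B where B: "finite B" "pairwise orthogonal B" "span B = T"
      "\<forall>b\<in>B. norm b = 1 \<and> (\<exists>l. f b = l *\<^sub>R b)"
      using less.hyps[OF _ sT] by blast
    have BT: "B \<subseteq> T" using B(3) span_superset by blast
    have "span (insert v B) = S"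
    proof
      show "span (insert v B) \<subseteq> S"
        using BT v(1) less.prems(1) by (intro span_minimal) (auto simp: T_def)
      show "S \<subseteq> span (insert v B)"
      proof
        fix x assume x: "x \<in> S"
        have "x - (v \<bullet> x) *\<^sub>R v \<in> T"
          using x v vv less.prems(1) by (auto simp: T_def inner_diff_right intro: subspace_diff subspace_scale)
        then show "x \<in> span (insert v B)"
          unfolding span_insert B(3) by blast
      qed
    qed
    moreover have "pairwise orthogonal (insert v B)"
      using B(2) BT by (auto simp: pairwise_insert T_def orthogonal_def inner_commute)
    ultimately show ?thesis using B v by (intro exI[of _ "insert v B"]) auto
  qed
qed

lemma symmetric_matrix_inner:
  "symmetric_matrix M \<Longrightarrow> (M *v x) \<bullet> y = x \<bullet> (M *v y)"
  by (metis dot_lmul_matrix symmetric_matrix_def transpose_matrix_vector)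

lemma symmetric_matrixI:
  assumes "\<And>x y. (M *v x) \<bullet> y = x \<bullet> (M *v y)" shows "symmetric_matrix M"
proof -
  have "(transpose M *v x) \<bullet> y = (M *v x) \<bullet> y" for x y
    by (metis assms dot_lmul_matrix transpose_matrix_vector)
  then have "transpose M *v x = M *v x" for x using vector_eq_rdot by blast
  then show ?thesis unfolding symmetric_matrix_def by (simp add: matrix_eq)
qed

text \<open>
  Scale every vector of an orthonormal eigenbasis by the square root of its eigenvalue.
\<close>

lemma psd_square_root_exists:
  fixes M :: "real ^ 'n ^ 'n"
  assumes sym: "symmetric_matrix M" and psd: "positive_semidefinite M"
  shows "\<exists>S. symmetric_matrix S \<and> positive_semidefinite S \<and> S ** S = M"
proof -
  obtain B where B: "finite B" "pairwise orthogonal B" "span B = (UNIV :: (real ^ 'n) set)"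
      and ev: "\<And>b. b \<in> B \<Longrightarrow> norm b = 1" "\<And>b. b \<in> B \<Longrightarrow> \<exists>l. M *v b = l *\<^sub>R b"
    using self_adjoint_orthonormal_eigenbasis[of "(*v) M" UNIV] symmetric_matrix_inner[OF sym]
    by auto
  define lam where "lam b = b \<bullet> (M *v b)" for b
  have lam0: "0 \<le> lam b" for b using psd by (simp add: lam_def positive_semidefinite_def)
  have lam: "M *v b = lam b *\<^sub>R b" if "b \<in> B" for b
    using ev[OF that] by (auto simp: lam_def norm_eq_1)
  have expand: "(\<Sum>b\<in>B. (x \<bullet> b) *\<^sub>R b) = x" for x
    using B ev by (intro orthonormal_basis_expand) auto
  define g where "g x = (\<Sum>b\<in>B. (sqrt (lam b) * (x \<bullet> b)) *\<^sub>R b)" for x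
  have lin: "linear g" unfolding g_def
    by (intro linearI) (simp_all add: inner_add_left algebra_simps sum.distrib scaleR_sum_right)
  have gb: "g b = sqrt (lam b) *\<^sub>R b" if "b \<in> B" for b
  proof -
    have "g b = (\<Sum>c\<in>B. if c = b then sqrt (lam b) *\<^sub>R b else 0)"
      unfolding g_def using that B(2) ev(1)
      by (intro sum.cong) (auto simp: norm_eq_1 pairwise_def orthogonal_def)
    then show ?thesis using that B(1) by simp
  qed
  have gg: "g (g x) = M *v x" for x
  proof -
    have "g (g x) = (\<Sum>b\<in>B. (sqrt (lam b) * (x \<bullet> b)) *\<^sub>R g b)"
      unfolding g_def[of x] by (simp add: linear_sum[OF lin] linear_scale[OF lin])
    also have "\<dots> = (\<Sum>b\<in>B. (x \<bullet> b) *\<^sub>R (M *v b))"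
      by (intro sum.cong) (auto simp: gb lam lam0)
    also have "\<dots> = M *v (\<Sum>b\<in>B. (x \<bullet> b) *\<^sub>R b)"
      by (simp add: linear_sum[OF matrix_vector_mul_linear] matrix_vector_mult_scaleR)
    finally show ?thesis by (simp add: expand)
  qed
  have gx: "matrix g *v x = g x" for x by (simp add: matrix_works lin)
  have ginner: "g x \<bullet> y = (\<Sum>b\<in>B. sqrt (lam b) * (x \<bullet> b) * (y \<bullet> b))" for x y
    unfolding g_def inner_sum_left by (intro sum.cong) (auto simp: inner_commute)
  have "symmetric_matrix (matrix g)"
    by (rule symmetric_matrixI) (simp add: gx ginner inner_commute[of _ "g _"] mult_ac)
  moreover have "positive_semidefinite (matrix g)"
    unfolding positive_semidefinite_def gx inner_commute[of _ "g _"] ginner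
    by (auto simp: lam0 mult.assoc simp del: mult_eq_0_iff intro!: sum_nonneg mult_nonneg_nonneg[OF _ zero_le_square])
  moreover have "matrix g ** matrix g = M"
    by (simp add: matrix_eq matrix_vector_mul_assoc[symmetric] gx gg)
  ultimately show ?thesis by blast
qed

text \<open>
  Uniqueness of the square root, in the form of an order. If \<open>v\<close> is an eigenvector
  of \<open>S - T\<close> for its largest eigenvalue \<open>l\<close>, then \<open>|S v| = |T
  v|\<close> turns into \<open>l (v \<bullet> S v + v \<bullet> T v) = 0\<close>, where the
  bracket is at least \<open>l\<close> and nonnegative; hence \<open>l \<le> 0\<close>.
  Exchanging \<open>S\<close> and \<open>T\<close> gives equality of the two forms.
\<close>

lemma psd_square_root_le:
  fixes S T :: "real ^ 'n ^ 'n"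
  assumes S: "symmetric_matrix S" "positive_semidefinite S"
    and T: "symmetric_matrix T" "positive_semidefinite T" and eq: "S ** S = T ** T"
  shows "x \<bullet> (S *v x) \<le> x \<bullet> (T *v x)"
proof -
  have adj: "((S - T) *v x) \<bullet> y = x \<bullet> ((S - T) *v y)" for x y
    by (simp add: matrix_vector_mult_diff_rdistrib inner_diff_left inner_diff_right
        symmetric_matrix_inner[OF S(1)] symmetric_matrix_inner[OF T(1)])
  have "(UNIV :: (real ^ 'n) set) \<noteq> {0}"
    by (metis UNIV_I axis_eq_0_iff singletonD zero_neq_one)
  then obtain v l where v: "norm v = 1" "(S - T) *v v = l *\<^sub>R v"
      and max: "\<And>x. x \<bullet> ((S - T) *v x) \<le> l * (x \<bullet> x)"
    using self_adjoint_extremal_eigenvector[of "(*v) (S - T)" UNIV] adj by auto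
  have sv: "S *v v = T *v v + l *\<^sub>R v"
    using v(2) by (simp add: matrix_vector_mult_diff_rdistrib algebra_simps)
  have vv: "v \<bullet> v = 1" using v by (simp add: norm_eq_1)
  have "(S *v v) \<bullet> (S *v v) = (T *v v) \<bullet> (T *v v)"
    using arg_cong[OF eq, of "\<lambda>N. v \<bullet> (N *v v)"]
    by (simp add: matrix_vector_mul_assoc[symmetric] symmetric_matrix_inner[OF S(1)]
        symmetric_matrix_inner[OF T(1)])
  then have "l * (v \<bullet> (S *v v) + v \<bullet> (T *v v)) = 0"
    by (simp add: sv inner_add_left inner_add_right inner_commute algebra_simps)
  moreover have "v \<bullet> (S *v v) = v \<bullet> (T *v v) + l" by (simp add: sv inner_add_right vv)
  moreover have "0 \<le> v \<bullet> (S *v v)" "0 \<le> v \<bullet> (T *v v)"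
    using S T by (auto simp: positive_semidefinite_def)
  ultimately have "l \<le> 0" by auto
  then have "l * (x \<bullet> x) \<le> 0" by (simp add: mult_nonpos_nonneg)
  then show ?thesis using max[of x]
    by (simp add: matrix_vector_mult_diff_rdistrib inner_diff_right)
qed

lemma symmetric_matrix_eqI:
  fixes S T :: "real ^ 'n ^ 'n"
  assumes S: "symmetric_matrix S" and T: "symmetric_matrix T"
    and eq: "\<And>x. x \<bullet> (S *v x) = x \<bullet> (T *v x)"
  shows "S = T"
proof -
  have "y \<bullet> (S *v x) = y \<bullet> (T *v x)" for x y
    using eq[of "x + y"] eq[of x] eq[of y] symmetric_matrix_inner[OF S, of y x]
      symmetric_matrix_inner[OF T, of y x]
    by (simp add: matrix_vector_right_distrib inner_add_left inner_add_right inner_commute)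
  then have "S *v x = T *v x" for x using vector_eq_ldot by blast
  then show ?thesis by (simp add: matrix_eq)
qed

text \<open>
  The definite description in \<^const>\<open>matrix_sqrt\<close> is meaningful because the
  square root exists and is unique.
\<close>

lemma matrix_sqrt_square:
  assumes "symmetric_matrix M" and "positive_semidefinite M"
  shows "matrix_sqrt M ** matrix_sqrt M = M"
proof -
  have "\<exists>!S. symmetric_matrix S \<and> positive_semidefinite S \<and> S ** S = M"
    using psd_square_root_exists[OF assms]
    by (metis (no_types, lifting) psd_square_root_le symmetric_matrix_eqI order_antisym)
  from theI'[OF this] show ?thesis unfolding matrix_sqrt_def by blast
qed

section \<open>The largest singular value as an operator norm\<close>

lemma inner_conj_transpose:
  fixes M :: "complex ^ 'n ^ 'm"
  shows "(conj_transpose M *v w) \<bullet> v = w \<bullet> (M *v v)"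
proof -
  have cnj_form: "x \<bullet> y = Re (\<Sum>i\<in>UNIV. cnj (x $ i) * y $ i)" for x y :: "complex ^ 'k"
    by (simp add: inner_vec_def inner_complex_def)
  have "(\<Sum>i\<in>UNIV. cnj ((conj_transpose M *v w) $ i) * v $ i)
      = (\<Sum>i\<in>UNIV. \<Sum>j\<in>UNIV. M $ j $ i * cnj (w $ j) * v $ i)"
    by (simp add: matrix_vector_mult_def conj_transpose_def sum_distrib_right)
  also have "\<dots> = (\<Sum>j\<in>UNIV. \<Sum>i\<in>UNIV. M $ j $ i * cnj (w $ j) * v $ i)"
    by (rule sum.swap)
  also have "\<dots> = (\<Sum>j\<in>UNIV. cnj (w $ j) * (M *v v) $ j)"
    by (simp add: matrix_vector_mult_def sum_distrib_left mult_ac)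
  finally show ?thesis by (simp only: cnj_form)
qed

lemma gram_inner:
  fixes M :: "complex ^ 'n ^ 'm"
  shows "v \<bullet> ((conj_transpose M ** M) *v w) = (M *v v) \<bullet> (M *v w)"
  by (metis inner_commute inner_conj_transpose matrix_vector_mul_assoc)

lemma complex_smult_of_real: "complex_of_real r *s v = r *\<^sub>R (v :: complex ^ 'n)"
  by (simp add: vec_eq_iff scaleR_conv_of_real[symmetric])

lemma norm_smult_complex: "norm (c *s v) = cmod c * norm (v :: complex ^ 'n)"
  by (simp add: norm_vec_def norm_mult L2_set_right_distrib)

lemma norm_of_singular_vector:
  assumes "(conj_transpose M ** M) *v v = complex_of_real (s\<^sup>2) *s v" and "0 \<le> s"
  shows "norm (M *v v) = s * norm v"
proof -
  have "(norm (M *v v))\<^sup>2 = s\<^sup>2 * (norm v)\<^sup>2"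
    using arg_cong[OF assms(1), of "\<lambda>x. v \<bullet> x"]
    unfolding complex_smult_of_real by (simp add: gram_inner power2_norm_eq_inner)
  then have "(norm (M *v v))\<^sup>2 = (s * norm v)\<^sup>2" by (simp add: power_mult_distrib)
  then show ?thesis using assms(2) by simp
qed

text \<open>
  The extremal eigenvector \<open>u\<close> of the Gram matrix maximizes \<open>|M u|\<close> on
  the unit sphere, and \<open>|M u|\<close> is itself a singular value that dominates all others.
  So the greatest singular value exists and is the operator norm.
\<close>

lemma sigma_max_properties:
  fixes M :: "complex ^ 'n ^ 'm"
  shows "0 \<le> sigma_max M" and "norm (M *v v) \<le> sigma_max M * norm v"
    and "\<exists>u. norm u = 1 \<and> norm (M *v u) = sigma_max M"
proof -
  let ?G = "conj_transpose M ** M"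
  have adj: "(?G *v x) \<bullet> y = x \<bullet> (?G *v y)" for x y
    by (metis gram_inner inner_commute)
  have "(UNIV :: (complex ^ 'n) set) \<noteq> {0}"
    by (metis UNIV_I axis_eq_0_iff singletonD zero_neq_one)
  then obtain u l where u: "norm u = 1" "?G *v u = l *\<^sub>R u"
      and max: "\<And>x. x \<bullet> (?G *v x) \<le> l * (x \<bullet> x)"
    using self_adjoint_extremal_eigenvector[of "(*v) ?G" UNIV] adj by auto
  have "u \<bullet> (?G *v u) = l" using u by (simp add: norm_eq_1)
  then have l: "l = (norm (M *v u))\<^sup>2" by (simp add: gram_inner power2_norm_eq_inner)
  define s where "s = norm (M *v u)"
  have bound: "norm (M *v x) \<le> s * norm x" for x
  proof -
    have "(norm (M *v x))\<^sup>2 \<le> (s * norm x)\<^sup>2"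
      using max[of x] by (simp add: gram_inner l s_def power2_norm_eq_inner power_mult_distrib)
    then show ?thesis by (rule power2_le_imp_le) (simp add: s_def)
  qed
  have "is_singular_value M s"
    using u l unfolding is_singular_value_def is_eigenvalue_def complex_smult_of_real
    by (auto simp: s_def intro!: exI[of _ u])
  moreover have "t \<le> s" if t: "is_singular_value M t" for t
  proof -
    obtain x where x: "x \<noteq> 0" "?G *v x = complex_of_real (t\<^sup>2) *s x" and "0 \<le> t"
      using t unfolding is_singular_value_def is_eigenvalue_def by blast
    then have "t * norm x \<le> s * norm x" using norm_of_singular_vector bound by metis
    then show ?thesis using x(1) by simp
  qed
  ultimately have "sigma_max M = s" unfolding sigma_max_def by (rule Greatest_equality)
  then show "0 \<le> sigma_max M" "norm (M *v v) \<le> sigma_max M * norm v"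
      "\<exists>u. norm u = 1 \<and> norm (M *v u) = sigma_max M"
    using bound u by (auto simp: s_def)
qed

lemma sigma_max_le_iff:
  assumes "0 \<le> g"
  shows "sigma_max M \<le> g \<longleftrightarrow> (\<forall>v. norm (M *v v) \<le> g * norm v)"
  by (metis assms mult.right_neutral mult_right_mono norm_ge_zero order_trans sigma_max_properties(2,3))

section \<open>Real matrices acting on complex vectors\<close>

definition complex_vector :: "real ^ 'n \<Rightarrow> complex ^ 'n"
  where "complex_vector x = (\<chi> i. complex_of_real (x $ i))"

definition Re_vector :: "complex ^ 'n \<Rightarrow> real ^ 'n" where "Re_vector v = (\<chi> i. Re (v $ i))"

definition Im_vector :: "complex ^ 'n \<Rightarrow> real ^ 'n" where "Im_vector v = (\<chi> i. Im (v $ i))"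

lemma complex_matrix_vector: "complex_matrix M *v complex_vector x = complex_vector (M *v x)"
  by (simp add: vec_eq_iff complex_matrix_def complex_vector_def matrix_vector_mult_def)

lemma Re_Im_complex_matrix:
  "Re_vector (complex_matrix M *v v) = M *v Re_vector v"
  "Im_vector (complex_matrix M *v v) = M *v Im_vector v"
  by (simp_all add: vec_eq_iff complex_matrix_def Re_vector_def Im_vector_def matrix_vector_mult_def)

lemma Re_Im_add:
  "Re_vector (v + w) = Re_vector v + Re_vector w" "Im_vector (v + w) = Im_vector v + Im_vector w"
  by (simp_all add: vec_eq_iff Re_vector_def Im_vector_def)

lemma Re_Im_smult:
  "Re_vector (c *s v) = Re c *\<^sub>R Re_vector v - Im c *\<^sub>R Im_vector v"
  "Im_vector (c *s v) = Re c *\<^sub>R Im_vector v + Im c *\<^sub>R Re_vector v"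
  by (simp_all add: vec_eq_iff Re_vector_def Im_vector_def)

lemma complex_vec_norm_sq: "(norm v)\<^sup>2 = (\<Sum>i\<in>UNIV. (cmod (v $ i))\<^sup>2)" for v :: "complex ^ 'n"
  by (simp add: norm_vec_def L2_set_def sum_nonneg)

lemma norm_Re_Im: "(norm v)\<^sup>2 = (norm (Re_vector v))\<^sup>2 + (norm (Im_vector v))\<^sup>2"
  by (simp add: norm_vec_def L2_set_def sum_nonneg Re_vector_def Im_vector_def cmod_power2 sum.distrib)

lemma complex_vector_simps:
  "complex_vector (x + y) = complex_vector x + complex_vector y"
  "norm (complex_vector x) = norm x" "complex_vector 0 = 0"
  by (simp_all add: complex_vector_def vec_eq_iff norm_vec_def)

lemma Re_Im_eq_0: "Re_vector v = 0 \<Longrightarrow> Im_vector v = 0 \<Longrightarrow> v = 0"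
  by (simp add: vec_eq_iff Re_vector_def Im_vector_def complex_eq_iff)

lemma smult_matrix_vector: "M *v (c *s v) = c *s (M *v v)" for M :: "complex ^ 'n ^ 'm"
  by (simp add: vec_eq_iff matrix_vector_mult_def sum_distrib_left mult_ac)

lemma mat_vector: "mat c *v v = c *s v" for v :: "complex ^ 'n"
  by (simp add: vec_eq_iff matrix_vector_mult_def mat_def if_distrib[where f="\<lambda>x. x * _"] cong: if_cong)

lemma matrix_inv_works:
  assumes "invertible M" shows "M ** matrix_inv M = mat 1" "matrix_inv M ** M = mat 1"
  using someI_ex[of "\<lambda>N. M ** N = mat 1 \<and> N ** M = mat 1"] assms
  unfolding invertible_def matrix_inv_def by blast+

lemma invertible_kernel: "invertible M \<longleftrightarrow> (\<forall>x. M *v x = 0 \<longrightarrow> x = 0)" for M :: "'a::field ^ 'n ^ 'n"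
  by (simp add: invertible_left_inverse matrix_left_invertible_ker)

section \<open>The frequency response on the unit circle\<close>

definition frequency_response ::
    "real ^ 'x ^ 'x \<Rightarrow> real ^ 'w ^ 'x \<Rightarrow> real ^ 'x ^ 'z \<Rightarrow> real \<Rightarrow> complex ^ 'w ^ 'z"
  where "frequency_response F G D \<omega> =
    complex_matrix D ** matrix_inv (mat (exp (\<i> * complex_of_real \<omega>)) - complex_matrix F) ** complex_matrix G"

definition hinf_norm :: "real ^ 'x ^ 'x \<Rightarrow> real ^ 'w ^ 'x \<Rightarrow> real ^ 'x ^ 'z \<Rightarrow> real"
  where "hinf_norm F G D = (GREATEST m. m \<in> (\<lambda>\<omega>. sigma_max (frequency_response F G D \<omega>)) ` {0..2 * pi})"

text \<open>
  Stability excludes eigenvalues of modulus \<open>1\<close>, so \<open>|e x - F x|\<close> is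
  positive on a product of two spheres; by compactness it is bounded away from zero. Uniformity
  in \<open>e\<close> gives both the continuity of the frequency response and the error estimate
  in \<open>zero_state_gain\<close>.
\<close>

lemma stable_resolvent_bound:
  fixes F :: "real ^ 'x ^ 'x"
  assumes "schur_stable F"
  obtains m where "0 < m"
    "\<And>e x. cmod e = 1 \<Longrightarrow> m * norm x \<le> norm (e *s x - complex_matrix F *v x)"
proof -
  let ?h = "\<lambda>(e, x). norm (e *s x - complex_matrix F *v x)"
  let ?K = "sphere (0::complex) 1 \<times> sphere (0 :: complex ^ 'x) 1"
  have "compact ?K" by (intro compact_Times compact_sphere)
  moreover have "(1, axis undefined 1) \<in> ?K" by simp
  then have "?K \<noteq> {}" by blast
  moreover have "continuous_on ?K ?h"
    unfolding case_prod_unfold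
  proof (intro continuous_on_norm continuous_on_diff)
    show "continuous_on ?K (\<lambda>p. fst p *s snd p)"
      unfolding vector_scalar_mult_def by (intro continuous_intros)
    show "continuous_on ?K (\<lambda>p. complex_matrix F *v snd p)"
      by (intro bounded_linear.continuous_on[OF matrix_vector_mul_bounded_linear] continuous_intros)
  qed
  ultimately obtain p where p: "p \<in> ?K" "\<And>q. q \<in> ?K \<Longrightarrow> ?h p \<le> ?h q"
    using continuous_attains_inf[of ?K ?h] by blast
  have pos: "0 < ?h p"
  proof -
    obtain e x where ex: "p = (e, x)" by (cases p)
    have "complex_matrix F *v x \<noteq> e *s x"
    proof
      assume "complex_matrix F *v x = e *s x"
      moreover have "x \<noteq> 0" using p(1) ex by auto
      ultimately have "is_eigenvalue (complex_matrix F) e" unfolding is_eigenvalue_def by blast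
      then show False using assms p(1) ex unfolding schur_stable_def by fastforce
    qed
    then show ?thesis using ex by simp
  qed
  show thesis
  proof (rule that[OF pos])
    fix e :: complex and x :: "complex ^ 'x" assume e: "cmod e = 1"
    show "?h p * norm x \<le> norm (e *s x - complex_matrix F *v x)"
    proof (cases "x = 0")
      case False
      define r where "r = complex_of_real (inverse (norm x))"
      have "?h p \<le> ?h (e, r *s x)"
        using e False by (intro p(2)) (simp add: norm_smult_complex r_def norm_inverse)
      also have "?h (e, r *s x) = norm (r *s (e *s x - complex_matrix F *v x))"
        by (simp add: smult_matrix_vector vector_ssub_ldistrib vector_smult_assoc mult.commute)
      also have "\<dots> = norm (e *s x - complex_matrix F *v x) / norm x"
        unfolding norm_smult_complex by (simp add: r_def norm_inverse divide_inverse mult.commute)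
      finally show ?thesis using False by (simp add: field_simps)
    qed simp
  qed
qed

lemma stable_resolvent:
  fixes F :: "real ^ 'x ^ 'x"
  assumes "schur_stable F" and "cmod e = 1"
  shows "e *s x - complex_matrix F *v x = y \<longleftrightarrow> x = matrix_inv (mat e - complex_matrix F) *v y"
proof -
  let ?N = "mat e - complex_matrix F"
  have N: "?N *v x = e *s x - complex_matrix F *v x" for x
    by (simp add: matrix_vector_mult_diff_rdistrib mat_vector)
  obtain m where m: "0 < m" "\<And>x. m * norm x \<le> norm (?N *v x)"
    using stable_resolvent_bound[OF assms(1)] assms(2) N by metis
  have "invertible ?N"
    unfolding invertible_kernel using m by (metis mult_le_0_iff norm_le_zero_iff norm_zero not_less)
  from matrix_inv_works[OF this] show ?thesis
    unfolding N[symmetric] by (metis matrix_vector_mul_assoc matrix_vector_mul_lid)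
qed

lemma frequency_response_vector:
  fixes F :: "real ^ 'x ^ 'x"
  assumes "schur_stable F"
    and "exp (\<i> * complex_of_real \<omega>) *s x - complex_matrix F *v x = complex_matrix G *v v"
  shows "frequency_response F G D \<omega> *v v = complex_matrix D *v x"
  using assms(2) stable_resolvent[OF assms(1), of "exp (\<i> * complex_of_real \<omega>)"]
  by (simp add: frequency_response_def matrix_vector_mul_assoc[symmetric] norm_exp_i_times)

lemma frequency_response_input:
  fixes F :: "real ^ 'x ^ 'x"
  assumes "schur_stable F"
  obtains x where "exp (\<i> * complex_of_real \<omega>) *s x - complex_matrix F *v x = complex_matrix G *v v"
  using stable_resolvent[OF assms, of "exp (\<i> * complex_of_real \<omega>)"] by (auto simp: norm_exp_i_times)

text \<open>The resolvent identity combined with the uniform resolvent bound.\<close>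

lemma frequency_response_lipschitz:
  fixes F :: "real ^ 'x ^ 'x" and G :: "real ^ 'w ^ 'x" and D :: "real ^ 'x ^ 'z"
  assumes stable: "schur_stable F"
  obtains L where "\<And>\<omega> \<omega>' v. norm (frequency_response F G D \<omega> *v v - frequency_response F G D \<omega>' *v v)
    \<le> L * cmod (exp (\<i> * complex_of_real \<omega>) - exp (\<i> * complex_of_real \<omega>')) * norm v"
proof -
  obtain m where m: "0 < m"
    "\<And>e x. cmod e = 1 \<Longrightarrow> m * norm x \<le> norm (e *s x - complex_matrix F *v x)"
    using stable_resolvent_bound[OF stable] by blast
  define d where "d = sigma_max (complex_matrix D)"
  define g where "g = sigma_max (complex_matrix G)"
  have d: "norm (complex_matrix D *v x) \<le> d * norm x" "0 \<le> d" for x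
    by (simp_all add: d_def sigma_max_properties)
  have g: "norm (complex_matrix G *v x) \<le> g * norm x" for x
    by (simp add: g_def sigma_max_properties)
  have "norm (frequency_response F G D \<omega> *v v - frequency_response F G D \<omega>' *v v)
    \<le> (d * g / m\<^sup>2) * cmod (exp (\<i> * complex_of_real \<omega>) - exp (\<i> * complex_of_real \<omega>')) * norm v" for \<omega> \<omega>' v
  proof -
    define e e' where "e = exp (\<i> * complex_of_real \<omega>)" and "e' = exp (\<i> * complex_of_real \<omega>')"
    obtain x where x: "e *s x - complex_matrix F *v x = complex_matrix G *v v"
      using frequency_response_input[OF stable] unfolding e_def by blast
    obtain x' where x': "e' *s x' - complex_matrix F *v x' = complex_matrix G *v v"
      using frequency_response_input[OF stable] unfolding e'_def by blast
    have e: "cmod e = 1" "cmod e' = 1" by (simp_all add: e_def e'_def)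
    have "e *s (x - x') - complex_matrix F *v (x - x') = (e' - e) *s x'"
      using x x' by (simp add: matrix_vector_mult_diff_distrib vector_ssub_ldistrib
          vector_sub_rdistrib algebra_simps)
    with m(2)[OF e(1), of "x - x'"] have 1: "m * norm (x - x') \<le> cmod (e - e') * norm x'"
      by (metis norm_minus_commute norm_smult_complex)
    have "m * norm x' \<le> g * norm v" using m(2)[OF e(2), of x'] x' g[of v] by simp
    then have 2: "norm x' \<le> g * norm v / m" using m(1) by (simp add: field_simps)
    have "norm (x - x') \<le> cmod (e - e') * norm x' / m" using 1 m(1) by (simp add: field_simps)
    also have "\<dots> \<le> cmod (e - e') * (g * norm v / m) / m"
      using 2 m(1) by (intro divide_right_mono mult_left_mono) auto
    finally have "d * norm (x - x') \<le> d * (cmod (e - e') * (g * norm v / m) / m)"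
      by (rule mult_left_mono) (rule d(2))
    with d(1)[of "x - x'"] have "norm (complex_matrix D *v (x - x'))
        \<le> d * (cmod (e - e') * (g * norm v / m) / m)" by (rule order_trans)
    also have "\<dots> = (d * g / m\<^sup>2) * cmod (e - e') * norm v"
      by (simp add: power2_eq_square)
    finally show ?thesis
      using frequency_response_vector[OF stable x[unfolded e_def], of D]
        frequency_response_vector[OF stable x'[unfolded e'_def], of D]
      by (simp add: matrix_vector_mult_diff_distrib e_def e'_def)
  qed
  then show thesis by (rule that)
qed

text \<open>
  By the Lipschitz estimate the largest singular value depends continuously on the frequency, so
  the maximum over a period is attained.
\<close>

lemma hinf_norm_attained:
  fixes F :: "real ^ 'x ^ 'x" and G :: "real ^ 'w ^ 'x" and D :: "real ^ 'x ^ 'z"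
  assumes stable: "schur_stable F"
  shows "\<exists>\<omega>\<in>{0..2 * pi}. hinf_norm F G D = sigma_max (frequency_response F G D \<omega>)"
    and "\<omega> \<in> {0..2 * pi} \<Longrightarrow> sigma_max (frequency_response F G D \<omega>) \<le> hinf_norm F G D"
proof -
  let ?T = "frequency_response F G D"
  obtain L where L: "\<And>\<omega> \<omega>' v. norm (?T \<omega> *v v - ?T \<omega>' *v v)
    \<le> L * cmod (exp (\<i> * complex_of_real \<omega>) - exp (\<i> * complex_of_real \<omega>')) * norm v"
    using frequency_response_lipschitz[OF stable] by blast
  let ?e = "\<lambda>\<omega> \<omega>'. \<bar>L\<bar> * cmod (exp (\<i> * complex_of_real \<omega>) - exp (\<i> * complex_of_real \<omega>'))"
  have step: "sigma_max (?T \<omega>) \<le> sigma_max (?T \<omega>') + ?e \<omega> \<omega>'" for \<omega> \<omega>'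
  proof (subst sigma_max_le_iff)
    show "0 \<le> sigma_max (?T \<omega>') + ?e \<omega> \<omega>'" by (simp add: sigma_max_properties(1))
    show "\<forall>v. norm (?T \<omega> *v v) \<le> (sigma_max (?T \<omega>') + ?e \<omega> \<omega>') * norm v"
    proof
      fix v
      have "norm (?T \<omega> *v v) \<le> norm (?T \<omega>' *v v) + norm (?T \<omega> *v v - ?T \<omega>' *v v)"
        by (rule norm_triangle_sub)
      also have "\<dots> \<le> sigma_max (?T \<omega>') * norm v + ?e \<omega> \<omega>' * norm v"
        by (intro add_mono sigma_max_properties order_trans[OF L] mult_right_mono) auto
      finally show "norm (?T \<omega> *v v) \<le> (sigma_max (?T \<omega>') + ?e \<omega> \<omega>') * norm v"
        by (simp add: algebra_simps)
    qed
  qed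
  have dist: "dist (sigma_max (?T \<omega>)) (sigma_max (?T \<omega>')) \<le> ?e \<omega> \<omega>'" for \<omega> \<omega>'
    using step[of \<omega> \<omega>'] step[of \<omega>' \<omega>] by (simp add: dist_real_def abs_le_iff norm_minus_commute)
  have "continuous_on {0..2 * pi} (\<lambda>\<omega>. sigma_max (?T \<omega>))"
    unfolding continuous_on_def
  proof
    fix \<omega>' assume "\<omega>' \<in> {0..2 * pi}"
    have "((\<lambda>\<omega>. ?e \<omega> \<omega>') \<longlongrightarrow> ?e \<omega>' \<omega>') (at \<omega>' within {0..2 * pi})"
      by (intro tendsto_intros)
    then have "((\<lambda>\<omega>. ?e \<omega> \<omega>') \<longlongrightarrow> 0) (at \<omega>' within {0..2 * pi})" by simp
    then show "((\<lambda>\<omega>. sigma_max (?T \<omega>)) \<longlongrightarrow> sigma_max (?T \<omega>')) (at \<omega>' within {0..2 * pi})"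
      unfolding tendsto_dist_iff[of _ "sigma_max (?T \<omega>')"]
      by (rule Lim_null_comparison[rotated]) (use dist in auto)
  qed
  then obtain \<omega>m where m: "\<omega>m \<in> {0..2 * pi}" "\<And>\<omega>. \<omega> \<in> {0..2 * pi} \<Longrightarrow> sigma_max (?T \<omega>) \<le> sigma_max (?T \<omega>m)"
    using continuous_attains_sup[of "{0..2 * pi}" "\<lambda>\<omega>. sigma_max (?T \<omega>)"] by auto
  have "hinf_norm F G D = sigma_max (?T \<omega>m)"
    unfolding hinf_norm_def by (rule Greatest_equality) (use m in auto)
  then show "\<exists>\<omega>\<in>{0..2 * pi}. hinf_norm F G D = sigma_max (?T \<omega>)"
    "\<omega> \<in> {0..2 * pi} \<Longrightarrow> sigma_max (?T \<omega>) \<le> hinf_norm F G D"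
    using m by auto
qed

lemma hinf_norm_nonneg: "schur_stable F \<Longrightarrow> 0 \<le> hinf_norm F G D"
  using hinf_norm_attained(1) sigma_max_properties(1) by metis

text \<open>
  The form in which the cost is used below. It avoids the resolvent: \<open>x\<close> is the
  phasor of the state in the steady state response to the input phasor \<open>v\<close> at the
  point \<open>e\<close> of the unit circle.
\<close>

lemma hinf_norm_le_iff:
  fixes F :: "real ^ 'x ^ 'x" and G :: "real ^ 'w ^ 'x" and D :: "real ^ 'x ^ 'z"
  assumes stable: "schur_stable F" and g: "0 \<le> g"
  shows "hinf_norm F G D \<le> g \<longleftrightarrow>
    (\<forall>e x v. cmod e = 1 \<longrightarrow> e *s x - complex_matrix F *v x = complex_matrix G *v v
      \<longrightarrow> norm (complex_matrix D *v x) \<le> g * norm v)"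
proof -
  have "hinf_norm F G D \<le> g \<longleftrightarrow> (\<forall>\<omega>\<in>{0..2 * pi}. sigma_max (frequency_response F G D \<omega>) \<le> g)"
    using hinf_norm_attained[OF stable] by (metis order_trans)
  also have "\<dots> \<longleftrightarrow> (\<forall>\<omega>\<in>{0..2 * pi}. \<forall>v. norm (frequency_response F G D \<omega> *v v) \<le> g * norm v)"
    by (simp add: sigma_max_le_iff[OF g])
  also have "\<dots> \<longleftrightarrow> (\<forall>\<omega>\<in>{0..2 * pi}. \<forall>x v. exp (\<i> * complex_of_real \<omega>) *s x - complex_matrix F *v x
      = complex_matrix G *v v \<longrightarrow> norm (complex_matrix D *v x) \<le> g * norm v)"
    using frequency_response_vector[OF stable] frequency_response_input[OF stable] by metis
  also have "\<dots> \<longleftrightarrow> (\<forall>e x v. cmod e = 1 \<longrightarrow> e *s x - complex_matrix F *v x = complex_matrix G *v v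
      \<longrightarrow> norm (complex_matrix D *v x) \<le> g * norm v)" (is "?L \<longleftrightarrow> ?R")
  proof
    assume L: ?L
    show ?R
    proof (intro allI impI)
      fix e x v
      assume e: "cmod e = 1" and x: "e *s x - complex_matrix F *v x = complex_matrix G *v v"
      have "e = exp (\<i> * complex_of_real (Arg2pi e))" using Arg2pi_eq[of e] e by simp
      moreover have "Arg2pi e \<in> {0..2 * pi}" using Arg2pi[of e] by auto
      ultimately show "norm (complex_matrix D *v x) \<le> g * norm v" using L x by metis
    qed
  next
    assume ?R
    then show ?L using norm_exp_i_times by blast
  qed
  finally show ?thesis .
qed

section \<open>Powers of a Schur stable matrix\<close>

lemma contraction_with_vanishing_perturbation:
  fixes a b :: "nat \<Rightarrow> real"
  assumes step: "\<And>k. a (Suc k) \<le> r * a k + b k" and a0: "\<And>k. 0 \<le> a k"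
    and r: "0 \<le> r" "r < 1" and b: "b \<longlonglongrightarrow> 0"
  shows "a \<longlonglongrightarrow> 0"
proof (rule LIMSEQ_I)
  fix \<epsilon> :: real assume \<epsilon>: "0 < \<epsilon>"
  have "0 < \<epsilon> / 2 * (1 - r)" using \<epsilon> r by simp
  from LIMSEQ_D[OF b this] obtain k0 where k0: "\<And>k. k \<ge> k0 \<Longrightarrow> b k \<le> \<epsilon> / 2 * (1 - r)"
    by (metis abs_le_D1 diff_zero less_imp_le real_norm_def)
  have bound: "a (k0 + j) \<le> \<epsilon> / 2 + r ^ j * a k0" for j
  proof (induction j)
    case 0
    then show ?case using \<epsilon> by simp
  next
    case (Suc j)
    have "a (k0 + Suc j) \<le> r * a (k0 + j) + \<epsilon> / 2 * (1 - r)"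
      using step[of "k0 + j"] k0[of "k0 + j"] by simp
    also have "\<dots> \<le> r * (\<epsilon> / 2 + r ^ j * a k0) + \<epsilon> / 2 * (1 - r)"
      using Suc r(1) by (intro add_right_mono mult_left_mono)
    finally show ?case by (simp add: field_simps)
  qed
  have "(\<lambda>j. r ^ j * a k0) \<longlonglongrightarrow> 0 * a k0"
    using r by (intro tendsto_intros LIMSEQ_realpow_zero) auto
  then have "(\<lambda>j. r ^ j * a k0) \<longlonglongrightarrow> 0" by simp
  from LIMSEQ_D[OF this, of "\<epsilon> / 2"] \<epsilon> obtain j0 where
    j0: "\<And>j. j \<ge> j0 \<Longrightarrow> r ^ j * a k0 < \<epsilon> / 2" by (fastforce simp: abs_less_iff)
  have "norm (a k - 0) < \<epsilon>" if "k \<ge> k0 + j0" for k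
  proof -
    have "a k \<le> \<epsilon> / 2 + r ^ (k - k0) * a k0" using bound[of "k - k0"] that by simp
    moreover have "j0 \<le> k - k0" using that by linarith
    then have "\<epsilon> / 2 + r ^ (k - k0) * a k0 < \<epsilon>" using j0[of "k - k0"] by simp
    ultimately show ?thesis using a0[of k] by simp
  qed
  then show "\<exists>no. \<forall>k\<ge>no. norm (a k - 0) < \<epsilon>" by blast
qed

text \<open>
  The vector \<open>p(N) v\<close>, the action of a polynomial on \<open>v\<close> through the
  matrix \<open>N\<close>.
\<close>

definition poly_action :: "complex ^ 'n ^ 'n \<Rightarrow> complex poly \<Rightarrow> complex ^ 'n \<Rightarrow> complex ^ 'n"
  where "poly_action N p v = (\<Sum>i\<le>degree p. coeff p i *s ((*v) N ^^ i) v)"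

lemma poly_action_altdef:
  "degree p \<le> n \<Longrightarrow> poly_action N p v = (\<Sum>i\<le>n. coeff p i *s ((*v) N ^^ i) v)"
  unfolding poly_action_def
  by (rule sum.mono_neutral_left) (auto simp: coeff_eq_0)

lemma matrix_power_linear:
  fixes N :: "complex ^ 'n ^ 'n"
  shows "((*v) N ^^ i) (x - y) = ((*v) N ^^ i) x - ((*v) N ^^ i) y"
    and "((*v) N ^^ i) (c *s x) = c *s ((*v) N ^^ i) x"
  by (induction i) (simp_all add: matrix_vector_mult_diff_distrib smult_matrix_vector)

lemma poly_action_linear_factor:
  "poly_action N ([:- l, 1:] * q) v = poly_action N q (N *v v - l *s v)"
proof -
  let ?P = "\<lambda>i. ((*v) N ^^ i) v"
  have eq: "[:- l, 1:] * q = pCons 0 q - smult l q" by simp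
  have "degree ([:- l, 1:] * q) \<le> Suc (degree q)"
    using degree_mult_le[of "[:- l, 1:]" q] by simp
  then have "poly_action N ([:- l, 1:] * q) v
      = (\<Sum>i\<le>Suc (degree q). coeff (pCons 0 q) i *s ?P i) - (\<Sum>i\<le>Suc (degree q). (l * coeff q i) *s ?P i)"
    by (simp add: poly_action_altdef eq vector_sub_rdistrib sum_subtractf del: sum.atMost_Suc mult_pCons_left)
  also have "(\<Sum>i\<le>Suc (degree q). coeff (pCons 0 q) i *s ?P i) = (\<Sum>i\<le>degree q. coeff q i *s ?P (Suc i))"
    by (subst sum.atMost_Suc_shift) simp
  also have "(\<Sum>i\<le>Suc (degree q). (l * coeff q i) *s ?P i) = (\<Sum>i\<le>degree q. (l * coeff q i) *s ?P i)"
    by (simp add: coeff_eq_0)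
  finally show ?thesis
    by (simp add: poly_action_def matrix_power_linear vector_ssub_ldistrib vector_smult_assoc
        sum_subtractf funpow_swap1 mult.commute)
qed

text \<open>
  Split off a root \<open>l\<close> of \<open>p\<close>; by induction the powers of
  \<open>N\<close> vanish on \<open>(N - l) v\<close>. If \<open>|l| < 1\<close>, the sequence
  \<open>N\<^sup>k v\<close> is a contraction up to this vanishing term. Otherwise
  \<open>l\<close> is no eigenvalue, and \<open>N - l\<close> can be inverted.
\<close>

lemma powers_vanish_on_annihilated_vector:
  fixes N :: "complex ^ 'n ^ 'n"
  assumes ev: "\<And>l. is_eigenvalue N l \<Longrightarrow> cmod l < 1"
  shows "p \<noteq> 0 \<Longrightarrow> poly_action N p v = 0 \<Longrightarrow> (\<lambda>k. ((*v) N ^^ k) v) \<longlonglongrightarrow> 0"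
proof (induction "degree p" arbitrary: p v)
  case 0
  then obtain c where "p = [:c:]" "c \<noteq> 0" by (metis degree_eq_zeroE pCons_0_0)
  then have "v = 0" using 0 by (simp add: poly_action_def)
  then have "((*v) N ^^ k) v = 0" for k by (induction k) auto
  then show ?case by simp
next
  case (Suc d)
  obtain l where "poly p l = 0" using alg_closed_imp_poly_has_root[of p] Suc.hyps(2) by auto
  then obtain q where p: "p = [:- l, 1:] * q" using poly_eq_0_iff_dvd by blast
  have "q \<noteq> 0" using Suc.prems(1) p by auto
  then have "degree q = d" using Suc.hyps(2) p by (simp add: degree_mult_eq del: mult_pCons_left)
  let ?u = "\<lambda>k. ((*v) N ^^ k) v"
  have "(\<lambda>k. ((*v) N ^^ k) (N *v v - l *s v)) \<longlonglongrightarrow> 0"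
    using Suc.hyps(1)[OF \<open>degree q = d\<close>[symmetric] \<open>q \<noteq> 0\<close>] Suc.prems(2) p
    by (simp add: poly_action_linear_factor del: mult_pCons_left)
  then have diff: "(\<lambda>k. N *v ?u k - l *s ?u k) \<longlonglongrightarrow> 0"
    by (simp add: matrix_power_linear funpow_swap1)
  show ?case
  proof (cases "cmod l < 1")
    case True
    have step: "norm (?u (Suc k)) \<le> cmod l * norm (?u k) + norm (N *v ?u k - l *s ?u k)" for k
      using norm_triangle_sub[of "N *v ?u k" "l *s ?u k"] by (simp add: norm_smult_complex)
    have "(\<lambda>k. norm (?u k)) \<longlonglongrightarrow> 0"
      by (rule contraction_with_vanishing_perturbation[OF step _ _ True tendsto_norm_zero[OF diff]])
        simp_all
    then show ?thesis by (rule tendsto_norm_zero_cancel)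
  next
    case False
    let ?M = "N - mat l"
    have M: "?M *v x = N *v x - l *s x" for x
      by (simp add: matrix_vector_mult_diff_rdistrib mat_vector)
    have "invertible ?M"
      unfolding invertible_kernel M using False ev[of l] unfolding is_eigenvalue_def
      by (metis eq_iff_diff_eq_0)
    then have "?u k = matrix_inv ?M *v (N *v ?u k - l *s ?u k)" for k
      by (metis M matrix_inv_works(2) matrix_vector_mul_assoc matrix_vector_mul_lid)
    moreover have "(\<lambda>k. matrix_inv ?M *v (N *v ?u k - l *s ?u k)) \<longlonglongrightarrow> matrix_inv ?M *v 0"
      by (intro bounded_linear.tendsto[OF _ diff] matrix_vector_mul_bounded_linear)
    ultimately show ?thesis by simp
  qed
qed

text \<open>
  There are more vectors \<open>v, N v, N\<^sup>2 v, \<dots>\<close> than the real dimension of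
  the space. A repetition among them has to be treated separately, because linear dependence is a
  property of the set and does not see it.
\<close>

lemma annihilating_polynomial_exists:
  fixes N :: "complex ^ 'n ^ 'n"
  shows "\<exists>p. p \<noteq> 0 \<and> poly_action N p v = 0"
proof -
  let ?u = "\<lambda>k. ((*v) N ^^ k) v"
  define d where "d = DIM(complex ^ 'n)"
  show ?thesis
  proof (cases "inj_on ?u {..d}")
    case False
    then obtain i j where "i \<noteq> j" "?u i = ?u j" unfolding inj_on_def by blast
    then obtain k l where kl: "k < l" "?u k = ?u l"
      by (cases i j rule: linorder_cases) auto
    define p :: "complex poly" where "p = monom 1 l - monom 1 k"
    have "coeff p l = 1" using kl by (simp add: p_def)
    then have "p \<noteq> 0" by auto
    have deg: "degree p \<le> l" unfolding p_def using kl
      by (intro degree_diff_le) (auto simp: degree_monom_eq)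
    have "poly_action N p v = (\<Sum>i\<le>l. (if i = l then ?u i else 0) - (if i = k then ?u i else 0))"
      unfolding poly_action_altdef[OF deg] by (intro sum.cong) (use kl in \<open>auto simp: p_def\<close>)
    also have "\<dots> = 0" using kl by (simp add: sum_subtractf)
    finally show ?thesis using \<open>p \<noteq> 0\<close> by blast
  next
    case True
    have "card (?u ` {..d}) = Suc d" by (simp only: card_image[OF True] card_atMost)
    then have "dependent (?u ` {..d})" by (intro dependent_biggerset) (simp add: d_def)
    then obtain c where c: "\<exists>x\<in>?u ` {..d}. c x \<noteq> 0" "(\<Sum>x\<in>?u ` {..d}. c x *\<^sub>R x) = 0"
      using dependent_finite[of "?u ` {..d}"] by blast
    define p where "p = (\<Sum>k\<le>d. monom (complex_of_real (c (?u k))) k)"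
    have coeff: "coeff p k = (if k \<le> d then complex_of_real (c (?u k)) else 0)" for k
      by (simp add: p_def coeff_sum)
    obtain k where "k \<le> d" "c (?u k) \<noteq> 0" using c(1) by blast
    then have "coeff p k \<noteq> 0" by (simp add: coeff)
    then have "p \<noteq> 0" by auto
    have deg: "degree p \<le> d" by (intro degree_le) (simp add: coeff)
    have "poly_action N p v = (\<Sum>k\<le>d. c (?u k) *\<^sub>R ?u k)"
      unfolding poly_action_altdef[OF deg] by (intro sum.cong) (auto simp: coeff complex_smult_of_real)
    also have "\<dots> = 0" using c(2) by (simp only: sum.reindex[OF True] o_def)
    finally show ?thesis using \<open>p \<noteq> 0\<close> by blast
  qed
qed

text \<open>
  Every vector is annihilated by some polynomial in \<open>F\<close>, and the eigenvalues of
  \<open>F\<close> are inside the unit disc.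
\<close>

lemma stable_powers_vanish:
  fixes F :: "real ^ 'x ^ 'x"
  assumes "schur_stable F"
  shows "(\<lambda>k. ((*v) F ^^ k) x) \<longlonglongrightarrow> 0"
proof -
  have eq: "((*v) (complex_matrix F) ^^ k) (complex_vector x) = complex_vector (((*v) F ^^ k) x)" for k
    by (induction k) (simp_all add: complex_matrix_vector)
  obtain p where "p \<noteq> 0" "poly_action (complex_matrix F) p (complex_vector x) = 0"
    using annihilating_polynomial_exists by blast
  then have "(\<lambda>k. complex_vector (((*v) F ^^ k) x)) \<longlonglongrightarrow> 0"
    unfolding eq[symmetric] using assms unfolding schur_stable_def
    by (intro powers_vanish_on_annihilated_vector) auto
  from tendsto_norm_zero[OF this] show ?thesis
    by (simp add: complex_vector_simps tendsto_norm_zero_iff)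
qed

section \<open>From the frequency domain to finite horizons\<close>

text \<open>
  Orthogonality of the discrete characters: for \<open>s \<noteq> t\<close> this is a geometric
  sum with a ratio \<open>r \<noteq> 1\<close>, \<open>r\<^sup>M = 1\<close>.
\<close>

lemma sum_roots_of_unity_powers:
  assumes "s < M" "t < M"
  shows "(\<Sum>k<M. cis (2 * pi * real k / real M) ^ s * cnj (cis (2 * pi * real k / real M)) ^ t)
    = (if s = t then of_nat M else 0)"
proof -
  define z where "z = (\<lambda>j. cis (2 * pi * real j / real M))"
  define r where "r = z s * cnj (z t)"
  have M: "M > 0" using assms by auto
  have unit: "z j * cnj (z j) = 1" for j
    by (simp add: z_def cis_cnj cis_mult)
  have summand: "cis (2 * pi * real k / real M) ^ s * cnj (cis (2 * pi * real k / real M)) ^ t = r ^ k" for k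
    by (simp add: r_def z_def cis_cnj power_mult_distrib Complex.DeMoivre mult_ac)
  show ?thesis
  proof (cases "s = t")
    case True
    then have "r = 1" using unit by (simp add: r_def)
    then show ?thesis unfolding summand using True by simp
  next
    case False
    have "r \<noteq> 1"
    proof
      assume "r = 1"
      then have "z s = z t" using unit[of t] unfolding r_def
        by (metis mult.assoc mult.commute mult.right_neutral)
      then show False using False assms Complex.bij_betw_roots_unity[OF M]
        unfolding z_def bij_betw_def inj_on_def by auto
    qed
    moreover have "r ^ M = 1"
    proof -
      have "z j ^ M = cis (2 * pi * real j)" for j
        using M by (simp add: z_def Complex.DeMoivre)
      then have "z j ^ M = 1" for j by (simp add: cis_multiple_2pi)
      then show ?thesis by (simp add: r_def power_mult_distrib flip: complex_cnj_power)
    qed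
    ultimately show ?thesis unfolding summand using False by (simp add: geometric_sum)
  qed
qed

lemma discrete_parseval_scalar:
  fixes u :: "nat \<Rightarrow> complex"
  shows "(\<Sum>k<M. (cmod (\<Sum>t<M. cis (2 * pi * real k / real M) ^ t * u t))\<^sup>2)
    = real M * (\<Sum>t<M. (cmod (u t))\<^sup>2)"
proof -
  let ?q = "\<lambda>k. cis (2 * pi * real k / real M)"
  have "complex_of_real (\<Sum>k<M. (cmod (\<Sum>t<M. ?q k ^ t * u t))\<^sup>2)
      = (\<Sum>k<M. \<Sum>s<M. \<Sum>t<M. (u s * cnj (u t)) * (?q k ^ s * cnj (?q k) ^ t))"
    unfolding of_real_sum complex_norm_square cnj_sum sum_product complex_cnj_mult complex_cnj_power
    by (intro sum.cong refl) (simp add: mult_ac)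
  also have "\<dots> = (\<Sum>s<M. \<Sum>t<M. (u s * cnj (u t)) * (\<Sum>k<M. ?q k ^ s * cnj (?q k) ^ t))"
    unfolding sum_distrib_left
    by (subst sum.swap, rule sum.cong[OF refl], subst sum.swap, rule refl)
  also have "\<dots> = (\<Sum>s<M. \<Sum>t<M. if s = t then u s * cnj (u s) * of_nat M else 0)"
    by (intro sum.cong refl) (simp add: sum_roots_of_unity_powers)
  also have "\<dots> = (\<Sum>s<M. u s * cnj (u s) * of_nat M)" by simp
  also have "\<dots> = complex_of_real (real M * (\<Sum>t<M. (cmod (u t))\<^sup>2))"
    unfolding of_real_mult of_real_sum complex_norm_square sum_distrib_left
    by (intro sum.cong refl) simp
  finally show ?thesis by (simp only: of_real_eq_iff)
qed

lemma discrete_parseval: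
  fixes u :: "nat \<Rightarrow> complex ^ 'n"
  shows "(\<Sum>k<M. (norm (\<Sum>t<M. cis (2 * pi * real k / real M) ^ t *s u t))\<^sup>2)
    = real M * (\<Sum>t<M. (norm (u t))\<^sup>2)"
  unfolding complex_vec_norm_sq
  by (subst (1 2) sum.swap) (simp add: discrete_parseval_scalar sum_distrib_left)

primrec trajectory :: "real ^ 'x ^ 'x \<Rightarrow> real ^ 'w ^ 'x \<Rightarrow> (nat \<Rightarrow> real ^ 'w) \<Rightarrow> real ^ 'x \<Rightarrow> nat \<Rightarrow> real ^ 'x"
  where "trajectory F G w x 0 = x"
  | "trajectory F G w x (Suc t) = F *v trajectory F G w x t + G *v w t"

lemma trajectory_cong:
  "(\<And>s. s < t \<Longrightarrow> w s = w' s) \<Longrightarrow> trajectory F G w x t = trajectory F G w' x t"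
  by (induction t) auto

lemma trajectory_free:
  "(\<And>s. s \<ge> N \<Longrightarrow> w s = 0) \<Longrightarrow> trajectory F G w x (N + k) = ((*v) F ^^ k) (trajectory F G w x N)"
  by (induction k) auto

text \<open>
  Transforming the state equation over a window of length \<open>M\<close> telescopes and leaves
  one boundary term, the state at time \<open>M\<close>. With \<open>q\<close> on the unit
  circle, \<open>cnj q\<close> is the point at which the frequency response is evaluated.
\<close>

lemma truncated_transform:
  fixes F :: "real ^ 'x ^ 'x" and G :: "real ^ 'w ^ 'x" and w :: "nat \<Rightarrow> real ^ 'w"
  assumes q: "cmod q = 1"
  defines "x \<equiv> trajectory F G w 0"
  shows "cnj q *s (\<Sum>t<M. q ^ t *s complex_vector (x t))
      - complex_matrix F *v (\<Sum>t<M. q ^ t *s complex_vector (x t))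
    = complex_matrix G *v (\<Sum>t<M. q ^ t *s complex_vector (w t)) - (cnj q * q ^ M) *s complex_vector (x M)"
proof (induction M)
  case 0
  then show ?case by (simp add: x_def complex_vector_simps)
next
  case (Suc M)
  have qq: "cnj q * q = 1" using q by (simp add: complex_norm_square[symmetric] mult.commute)
  have shift: "cnj q * q ^ Suc M = q ^ M" using qq by (simp add: mult.assoc[symmetric])
  have "(cnj q * q ^ Suc M) *s complex_vector (x (Suc M))
      = q ^ M *s (complex_matrix F *v complex_vector (x M)) + q ^ M *s (complex_matrix G *v complex_vector (w M))"
    unfolding shift by (simp add: x_def complex_vector_simps complex_matrix_vector vector_add_ldistrib)
  then show ?case using Suc
    by (simp add: vector_add_ldistrib matrix_vector_right_distrib smult_matrix_vector vector_smult_assoc algebra_simps)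
qed

text \<open>
  The frequency domain bound \<open>|Z| \<le> \<gamma> |W|\<close> holds for the transform over a
  window of length \<open>M\<close> up to the boundary term, which is bounded by a multiple of
  the state at time \<open>M\<close>. The inputs after time \<open>N\<close> are switched off, so
  that this state tends to zero and the transform of the input stays bounded. Summing over the
  \<open>M\<close>-th roots of unity (Parseval) and letting \<open>M\<close> tend to infinity
  removes the boundary term.
\<close>

lemma zero_state_gain:
  fixes F :: "real ^ 'x ^ 'x" and G :: "real ^ 'w ^ 'x" and D :: "real ^ 'x ^ 'z"
  assumes stable: "schur_stable F" and gain: "hinf_norm F G D \<le> \<gamma>"
  shows "(\<Sum>t<N. (norm (D *v trajectory F G w 0 t))\<^sup>2) \<le> \<gamma>\<^sup>2 * (\<Sum>t<N. (norm (w t))\<^sup>2)"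
proof -
  define w' where "w' t = (if t < N then w t else 0)" for t
  define x where "x = trajectory F G w' 0"
  have \<gamma>: "0 \<le> \<gamma>" using hinf_norm_nonneg[OF stable] gain by (rule order_trans)
  obtain m where m: "0 < m"
    "\<And>e x. cmod e = 1 \<Longrightarrow> m * norm x \<le> norm (e *s x - complex_matrix F *v x)"
    using stable_resolvent_bound[OF stable] by blast
  define d where "d = sigma_max (complex_matrix D)"
  have d: "norm (complex_matrix D *v v) \<le> d * norm v" "0 \<le> d" for v
    by (simp_all add: d_def sigma_max_properties)
  define b where "b = (\<Sum>t<N. norm (w t))"
  have b: "0 \<le> b" by (simp add: b_def sum_nonneg)
  define c where "c = d / m"
  have c: "0 \<le> c" using d m by (simp add: c_def)
  have bound: "(\<Sum>t<N. (norm (D *v x t))\<^sup>2)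
      \<le> \<gamma>\<^sup>2 * (\<Sum>t<N. (norm (w t))\<^sup>2) + (2 * \<gamma> * b * (c * norm (x M)) + (c * norm (x M))\<^sup>2)"
    if M: "M \<ge> N" "M > 0" for M
  proof -
    let ?q = "\<lambda>k. cis (2 * pi * real k / real M)"
    define W where "W k = (\<Sum>t<M. ?q k ^ t *s complex_vector (w' t))" for k
    define X where "X k = (\<Sum>t<M. ?q k ^ t *s complex_vector (x t))" for k
    have W: "norm (W k) \<le> b" for k
    proof -
      have "norm (W k) \<le> (\<Sum>t<M. norm (?q k ^ t *s complex_vector (w' t)))"
        unfolding W_def by (rule norm_sum)
      also have "\<dots> = (\<Sum>t<M. norm (w' t))"
        by (simp add: norm_smult_complex norm_power complex_vector_simps)
      also have "\<dots> = (\<Sum>t<N. norm (w' t))"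
        using M by (intro sum.mono_neutral_right) (auto simp: w'_def)
      finally show ?thesis by (simp add: b_def w'_def)
    qed
    have Z: "norm (complex_matrix D *v X k) \<le> \<gamma> * norm (W k) + c * norm (x M)" for k
    proof -
      let ?e = "cnj (?q k)"
      have e: "cmod ?e = 1" by simp
      \<comment> \<open>\<open>Y\<close> is the exact response to the transformed input; \<open>X k\<close> differs from it by the
        response to the boundary term.\<close>
      obtain Y where Y: "?e *s Y - complex_matrix F *v Y = complex_matrix G *v W k"
        using stable_resolvent[OF stable e] by blast
      have "?e *s X k - complex_matrix F *v X k
          = complex_matrix G *v W k - (?e * ?q k ^ M) *s complex_vector (x M)"
        unfolding X_def W_def x_def by (rule truncated_transform) simp
      then have "?e *s (X k - Y) - complex_matrix F *v (X k - Y) = - ((?e * ?q k ^ M) *s complex_vector (x M))"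
        using Y by (simp add: matrix_vector_mult_diff_distrib algebra_simps)
      then have "m * norm (X k - Y) \<le> norm ((?e * ?q k ^ M) *s complex_vector (x M))"
        using m(2)[OF e, of "X k - Y"] by (metis norm_minus_cancel)
      then have "m * norm (X k - Y) \<le> norm (x M)"
        by (simp add: norm_smult_complex norm_mult norm_power complex_vector_simps)
      then have "d * (m * norm (X k - Y)) \<le> d * norm (x M)"
        by (rule mult_left_mono) (rule d(2))
      then have "d * norm (X k - Y) \<le> c * norm (x M)"
        using m(1) by (simp add: c_def field_simps)
      with d(1)[of "X k - Y"] have 1: "norm (complex_matrix D *v (X k - Y)) \<le> c * norm (x M)"
        by (rule order_trans)
      have 2: "norm (complex_matrix D *v Y) \<le> \<gamma> * norm (W k)"
        using gain hinf_norm_le_iff[OF stable \<gamma>] e Y by blast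
      have split: "complex_matrix D *v X k = complex_matrix D *v Y + complex_matrix D *v (X k - Y)"
        by (simp add: matrix_vector_mult_diff_distrib)
      show ?thesis unfolding split by (rule norm_triangle_le) (rule add_mono[OF 2 1])
    qed
    have "complex_matrix D *v X k = (\<Sum>t<M. ?q k ^ t *s complex_vector (D *v x t))" for k
      unfolding X_def by (simp add: linear_sum[OF matrix_vector_mul_linear] smult_matrix_vector complex_matrix_vector)
    then have DX: "(\<Sum>k<M. (norm (complex_matrix D *v X k))\<^sup>2) = real M * (\<Sum>t<M. (norm (D *v x t))\<^sup>2)"
      using discrete_parseval[of M "\<lambda>t. complex_vector (D *v x t)"] by (simp add: complex_vector_simps)
    have WW: "(\<Sum>k<M. (norm (W k))\<^sup>2) = real M * (\<Sum>t<M. (norm (w' t))\<^sup>2)"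
      using discrete_parseval[of M "\<lambda>t. complex_vector (w' t)"] by (simp add: W_def complex_vector_simps)
    let ?r = "2 * \<gamma> * b * (c * norm (x M)) + (c * norm (x M))\<^sup>2"
    have "(norm (complex_matrix D *v X k))\<^sup>2 \<le> \<gamma>\<^sup>2 * (norm (W k))\<^sup>2 + ?r" for k
    proof -
      have "(norm (complex_matrix D *v X k))\<^sup>2 \<le> (\<gamma> * norm (W k) + c * norm (x M))\<^sup>2"
        using Z by (rule power_mono) simp
      also have "\<dots> = \<gamma>\<^sup>2 * (norm (W k))\<^sup>2 + 2 * \<gamma> * norm (W k) * (c * norm (x M)) + (c * norm (x M))\<^sup>2"
        by (simp add: power2_sum power_mult_distrib)
      also have "2 * \<gamma> * norm (W k) * (c * norm (x M)) \<le> 2 * \<gamma> * b * (c * norm (x M))"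
        using W \<gamma> c by (intro mult_right_mono mult_left_mono) auto
      finally show ?thesis by linarith
    qed
    then have "(\<Sum>k<M. (norm (complex_matrix D *v X k))\<^sup>2) \<le> (\<Sum>k<M. \<gamma>\<^sup>2 * (norm (W k))\<^sup>2 + ?r)"
      by (rule sum_mono)
    also have "\<dots> = real M * (\<gamma>\<^sup>2 * (\<Sum>t<M. (norm (w' t))\<^sup>2) + ?r)"
      by (simp add: sum.distrib WW sum_distrib_left[symmetric] algebra_simps)
    finally have "(\<Sum>t<M. (norm (D *v x t))\<^sup>2) \<le> \<gamma>\<^sup>2 * (\<Sum>t<M. (norm (w' t))\<^sup>2) + ?r"
      using M(2) unfolding DX by simp
    moreover have "(\<Sum>t<N. (norm (D *v x t))\<^sup>2) \<le> (\<Sum>t<M. (norm (D *v x t))\<^sup>2)"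
      using M by (intro sum_mono2) auto
    moreover have "(\<Sum>t<M. (norm (w' t))\<^sup>2) = (\<Sum>t<N. (norm (w t))\<^sup>2)"
      using M by (intro sum.mono_neutral_cong_right) (auto simp: w'_def)
    ultimately show ?thesis by simp
  qed
  have "(\<lambda>k. x (N + k)) \<longlonglongrightarrow> 0"
    unfolding x_def using stable_powers_vanish[OF stable]
    by (subst trajectory_free) (auto simp: w'_def)
  then have xlim: "x \<longlonglongrightarrow> 0" using LIMSEQ_offset[of x N] by (simp add: add.commute)
  have "(\<lambda>M. \<gamma>\<^sup>2 * (\<Sum>t<N. (norm (w t))\<^sup>2) + (2 * \<gamma> * b * (c * norm (x M)) + (c * norm (x M))\<^sup>2))
      \<longlonglongrightarrow> \<gamma>\<^sup>2 * (\<Sum>t<N. (norm (w t))\<^sup>2) + (2 * \<gamma> * b * (c * norm (0 :: real ^ 'x)) + (c * norm (0 :: real ^ 'x))\<^sup>2)"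
    by (intro tendsto_intros xlim)
  then have "(\<Sum>t<N. (norm (D *v x t))\<^sup>2) \<le> \<gamma>\<^sup>2 * (\<Sum>t<N. (norm (w t))\<^sup>2)
      + (2 * \<gamma> * b * (c * norm (0 :: real ^ 'x)) + (c * norm (0 :: real ^ 'x))\<^sup>2)"
    by (rule LIMSEQ_le_const) (use bound in \<open>auto intro!: exI[of _ "Suc N"]\<close>)
  moreover have "x t = trajectory F G w 0 t" if "t < N" for t
    unfolding x_def using that by (intro trajectory_cong) (simp add: w'_def)
  ultimately show ?thesis by simp
qed

section \<open>Quadratic forms from the parallelogram inequality\<close>

text \<open>
  Cauchy's functional equation. The deviation from linearity is additive and vanishes at the
  integers, so it is periodic and hence bounded; a bounded additive function is zero.
\<close>

lemma additive_bounded_imp_homogeneous: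
  fixes g :: "real \<Rightarrow> real"
  assumes add: "\<And>r s. g (r + s) = g r + g s" and bound: "\<And>r. \<bar>r\<bar> \<le> 1 \<Longrightarrow> \<bar>g r\<bar> \<le> M"
  shows "g r = r * g 1"
proof -
  define h where "h r = g r - r * g 1" for r
  have hadd: "h (r + s) = h r + h s" for r s by (simp add: h_def add algebra_simps)
  have h1: "h 1 = 0" and h0: "h 0 = 0" using hadd[of 0 0] by (simp_all add: h_def)
  have hneg: "h (- r) = - h r" for r using hadd[of r "- r"] h0 by simp
  have hmult: "h (real n * r) = real n * h r" for n r
    by (induction n) (simp_all add: h0 hadd algebra_simps)
  have hnat: "h (real n) = 0" for n using hmult[of n 1] h1 by simp
  have hint: "h (of_int k) = 0" for k
    using hnat[of "nat k"] hnat[of "nat (- k)"] hneg[of "of_int k"] by (cases "0 \<le> k") auto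
  have hb: "\<bar>h r\<bar> \<le> 2 * M" for r
  proof -
    have eq: "h r = h (frac r)" using hadd[of "frac r" "of_int \<lfloor>r\<rfloor>"] hint by (simp add: frac_def)
    have f: "\<bar>frac r\<bar> \<le> 1" using frac_ge_0[of r] frac_lt_1[of r] by simp
    have "\<bar>h (frac r)\<bar> \<le> \<bar>g (frac r)\<bar> + \<bar>frac r\<bar> * \<bar>g 1\<bar>"
      unfolding h_def abs_mult[symmetric] by (rule abs_triangle_ineq4)
    also have "\<dots> \<le> M + 1 * M"
      using bound[OF f] bound[of 1] f by (intro add_mono mult_mono) auto
    finally show ?thesis by (simp add: eq)
  qed
  have "h r = 0"
  proof (rule ccontr)
    assume "h r \<noteq> 0"
    then obtain n :: nat where "2 * M < real n * \<bar>h r\<bar>"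
      using reals_Archimedean3[of "\<bar>h r\<bar>"] by auto
    also have "\<dots> = \<bar>h (real n * r)\<bar>" by (simp add: hmult abs_mult)
    also have "\<dots> \<le> 2 * M" by (rule hb)
    finally show False by simp
  qed
  then show ?thesis by (simp add: h_def)
qed

text \<open>
  The Jordan--von Neumann argument. Half of the parallelogram law suffices: applied to \<open>x +
  y\<close> and \<open>x - y\<close> it turns, by homogeneity, into the opposite inequality.
\<close>

lemma quadratic_form_of_parallelogram:
  fixes V :: "real ^ 'n \<Rightarrow> real"
  assumes scale: "\<And>c x. V (c *\<^sub>R x) = c\<^sup>2 * V x"
    and super: "\<And>x y. 2 * V x + 2 * V y \<le> V (x + y) + V (x - y)"
    and bound: "\<And>x. \<bar>V x\<bar> \<le> c * (norm x)\<^sup>2"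
  obtains P where "symmetric_matrix P" "\<And>x. V x = x \<bullet> (P *v x)"
proof -
  have par: "V (x + y) + V (x - y) = 2 * V x + 2 * V y" for x y
    using super[of x y] super[of "x + y" "x - y"] scale[of 2 x] scale[of 2 y]
    by (simp add: scaleR_2)
  have V0: "V 0 = 0" using scale[of 0 0] by simp
  have Vneg: "V (- x) = V x" for x using scale[of "- 1" x] by simp
  define b where "b x y = V (x + y) - V x - V y" for x y
  have sym: "b x y = b y x" for x y by (simp add: b_def add.commute)
  have add: "b (x + z) y = b x y + b z y" for x y z
  proof -
    have "V (x + y + z) + V (x + y - z) = 2 * V (x + y) + 2 * V z" by (rule par)
    moreover have "V (x + y + z) + V (x - (y - z)) = 2 * V (x + z) + 2 * V y"
      using par[of "x + z" y] by (simp add: algebra_simps)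
    moreover have "V (x + y - z) + V (x - (y - z)) = 2 * V x + 2 * V (y - z)"
      using par[of x "y - z"] by (simp add: algebra_simps)
    moreover have "V (y + z) + V (y - z) = 2 * V y + 2 * V z" by (rule par)
    moreover have e: "x + z + y = x + y + z" "z + y = y + z" by simp_all
    ultimately show ?thesis unfolding b_def e by linarith
  qed
  have c0: "0 \<le> c * (norm x)\<^sup>2" for x :: "real ^ 'n"
    using bound[of x] by (meson abs_ge_zero order_trans)
  have hom: "b (r *\<^sub>R x) y = r * b x y" for r x y
  proof -
    have "\<bar>b (s *\<^sub>R x) y\<bar> \<le> c * (norm (x + y))\<^sup>2 + c * (norm (x - y))\<^sup>2 + 4 * (c * (norm x)\<^sup>2 + c * (norm y)\<^sup>2)"
      if s: "\<bar>s\<bar> \<le> 1" for s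
    proof -
      have s2: "s\<^sup>2 \<le> 1" using s by (simp add: abs_square_le_1)
      have Vs: "\<bar>V (s *\<^sub>R x)\<bar> \<le> c * (norm x)\<^sup>2"
      proof -
        have "\<bar>V (s *\<^sub>R x)\<bar> = s\<^sup>2 * \<bar>V x\<bar>" by (simp add: scale abs_mult)
        also have "\<dots> \<le> 1 * (c * (norm x)\<^sup>2)" using s2 bound[of x] by (intro mult_mono) auto
        finally show ?thesis by simp
      qed
      have "norm (s *\<^sub>R x + y) \<le> norm x + norm y"
        using norm_triangle_ineq[of "s *\<^sub>R x" y] mult_right_mono[OF s, of "norm x"] by simp
      then have "(norm (s *\<^sub>R x + y))\<^sup>2 \<le> (norm x + norm y)\<^sup>2" by (rule power_mono) simp
      also have "\<dots> \<le> 2 * (norm x)\<^sup>2 + 2 * (norm y)\<^sup>2"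
        using sum_squares_bound[of "norm x" "norm y"] by (simp add: power2_sum)
      finally have n: "(norm (s *\<^sub>R x + y))\<^sup>2 \<le> 2 * (norm x)\<^sup>2 + 2 * (norm y)\<^sup>2" .
      have "0 \<le> c" using c0[of "axis undefined 1"] by simp
      from mult_left_mono[OF n this] have "\<bar>V (s *\<^sub>R x + y)\<bar> \<le> 2 * (c * (norm x)\<^sup>2) + 2 * (c * (norm y)\<^sup>2)"
        using bound[of "s *\<^sub>R x + y"] by (simp add: algebra_simps)
      then show ?thesis
        using Vs bound[of y] c0[of x] c0[of y] c0[of "x + y"] c0[of "x - y"]
        unfolding b_def distrib_left by linarith
    qed
    then have "b (r *\<^sub>R x) y = r * b (1 *\<^sub>R x) y"
      by (intro additive_bounded_imp_homogeneous[of "\<lambda>s. b (s *\<^sub>R x) y"]) (simp_all add: scaleR_left_distrib add)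
    then show ?thesis by simp
  qed
  have lin: "linear (b x)" for x
    by (intro linearI) (metis add sym, metis hom sym real_scaleR_def)
  define f where "f x = (\<chi> i. b x (axis i 1) / 2)" for x
  have linf: "linear f"
    by (intro linearI) (simp_all add: f_def vec_eq_iff add hom add_divide_distrib)
  have f: "y \<bullet> f x = b x y / 2" for x y
  proof -
    have "b x y = b x (\<Sum>i\<in>UNIV. y $ i *\<^sub>R axis i 1)"
      by (simp add: basis_expansion[of y, unfolded scalar_mult_eq_scaleR])
    also have "\<dots> = (\<Sum>i\<in>UNIV. y $ i * b x (axis i 1))"
      by (simp add: linear_sum[OF lin] linear_scale[OF lin])
    finally show ?thesis by (simp add: f_def inner_vec_def sum_divide_distrib)
  qed
  have P: "matrix f *v x = f x" for x by (simp add: matrix_works linf)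
  have "symmetric_matrix (matrix f)"
    by (rule symmetric_matrixI) (simp add: P f inner_commute[of "f _"] sym)
  moreover have "V x = x \<bullet> (matrix f *v x)" for x
    using scale[of 2 x] by (simp add: P f b_def flip: scaleR_2)
  ultimately show thesis by (rule that)
qed

section \<open>The available storage\<close>

definition net_energy ::
    "real ^ 'x ^ 'x \<Rightarrow> real ^ 'w ^ 'x \<Rightarrow> real ^ 'x ^ 'z \<Rightarrow> real \<Rightarrow> nat \<Rightarrow> (nat \<Rightarrow> real ^ 'w) \<Rightarrow> real ^ 'x \<Rightarrow> real"
  where "net_energy F G D \<gamma> N w x =
    (\<Sum>t<N. (norm (D *v trajectory F G w x t))\<^sup>2 - \<gamma>\<^sup>2 * (norm (w t))\<^sup>2)"

definition available_storage ::
    "real ^ 'x ^ 'x \<Rightarrow> real ^ 'w ^ 'x \<Rightarrow> real ^ 'x ^ 'z \<Rightarrow> real \<Rightarrow> real ^ 'x \<Rightarrow> real"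
  where "available_storage F G D \<gamma> x = (SUP (N, w). net_energy F G D \<gamma> N w x)"

lemma trajectory_scale:
  "trajectory F G (\<lambda>t. c *\<^sub>R w t) (c *\<^sub>R x) t = c *\<^sub>R trajectory F G w x t"
  by (induction t) (simp_all add: matrix_vector_mult_scaleR scaleR_right_distrib)

lemma trajectory_add:
  "trajectory F G (\<lambda>t. w t + w' t) (x + y) t = trajectory F G w x t + trajectory F G w' y t"
  by (induction t) (simp_all add: matrix_vector_right_distrib)

lemma trajectory_diff:
  "trajectory F G (\<lambda>t. w t - w' t) (x - y) t = trajectory F G w x t - trajectory F G w' y t"
  by (induction t) (simp_all add: matrix_vector_mult_diff_distrib)

lemma trajectory_shift:
  "trajectory F G w x (Suc t) = trajectory F G (\<lambda>t. w (Suc t)) (F *v x + G *v w 0) t"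
  by (induction t) simp_all

lemma net_energy_shift:
  "net_energy F G D \<gamma> (Suc N) w x = (norm (D *v x))\<^sup>2 - \<gamma>\<^sup>2 * (norm (w 0))\<^sup>2
    + net_energy F G D \<gamma> N (\<lambda>t. w (Suc t)) (F *v x + G *v w 0)"
  unfolding net_energy_def sum.lessThan_Suc_shift trajectory_shift by simp

lemma net_energy_scale:
  "net_energy F G D \<gamma> N (\<lambda>t. c *\<^sub>R w t) (c *\<^sub>R x) = c\<^sup>2 * net_energy F G D \<gamma> N w x"
  unfolding net_energy_def trajectory_scale
  by (simp add: matrix_vector_mult_scaleR power_mult_distrib sum_distrib_left algebra_simps)

lemma net_energy_parallelogram:
  "net_energy F G D \<gamma> N (\<lambda>t. w t + w' t) (x + y) + net_energy F G D \<gamma> N (\<lambda>t. w t - w' t) (x - y)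
    = 2 * net_energy F G D \<gamma> N w x + 2 * net_energy F G D \<gamma> N w' y"
proof -
  have sq: "(norm (a + b))\<^sup>2 + (norm (a - b))\<^sup>2 = 2 * (norm a)\<^sup>2 + 2 * (norm b)\<^sup>2" for a b :: "real ^ 'k"
    by (simp add: power2_norm_eq_inner inner_add_left inner_add_right inner_diff_left inner_diff_right)
  have "(norm (D *v (trajectory F G w x t + trajectory F G w' y t)))\<^sup>2 - \<gamma>\<^sup>2 * (norm (w t + w' t))\<^sup>2
      + ((norm (D *v (trajectory F G w x t - trajectory F G w' y t)))\<^sup>2 - \<gamma>\<^sup>2 * (norm (w t - w' t))\<^sup>2)
      = 2 * ((norm (D *v trajectory F G w x t))\<^sup>2 - \<gamma>\<^sup>2 * (norm (w t))\<^sup>2)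
      + 2 * ((norm (D *v trajectory F G w' y t))\<^sup>2 - \<gamma>\<^sup>2 * (norm (w' t))\<^sup>2)" for t
    using sq[of "D *v trajectory F G w x t" "D *v trajectory F G w' y t"]
      arg_cong[OF sq[of "w t" "w' t"], of "\<lambda>r. \<gamma>\<^sup>2 * r"]
    by (simp add: matrix_vector_right_distrib matrix_vector_mult_diff_distrib algebra_simps)
  then show ?thesis
    unfolding net_energy_def trajectory_add trajectory_diff sum_distrib_left sum.distrib[symmetric]
    by (intro sum.cong refl)
qed

text \<open>
  Waiting with zero input beyond the horizon only adds output energy. This makes the suprema over
  different horizons comparable.
\<close>

lemma net_energy_extend:
  assumes "N \<le> M"
  shows "net_energy F G D \<gamma> N w x \<le> net_energy F G D \<gamma> M (\<lambda>t. if t < N then w t else 0) x"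
proof -
  let ?w = "\<lambda>t. if t < N then w t else 0"
  have "net_energy F G D \<gamma> N w x = net_energy F G D \<gamma> N ?w x"
    unfolding net_energy_def
    by (intro sum.cong refl arg_cong2[of _ _ _ _ "(-)"] arg_cong[where f = "\<lambda>v. (norm (D *v v))\<^sup>2"] trajectory_cong) auto
  also have "\<dots> \<le> net_energy F G D \<gamma> M ?w x"
    unfolding net_energy_def using assms by (intro sum_mono2) auto
  finally show ?thesis .
qed

text \<open>
  The certificate is the available storage, written \<open>?V\<close>. The choice \<open>x +
  y\<close>, \<open>x - y\<close> of initial states with inputs \<open>w + w'\<close>, \<open>w -
  w'\<close> shows the parallelogram inequality \<open>super\<close>; prepending one input
  \<open>w\<close> to a nearly optimal continuation shows the dissipation inequality
  \<open>step\<close>.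
\<close>

lemma storage_certificate:
  fixes F :: "real ^ 'x ^ 'x" and G :: "real ^ 'w ^ 'x" and D :: "real ^ 'x ^ 'z"
  assumes gain: "\<And>N w. (\<Sum>t<N. (norm (D *v trajectory F G w 0 t))\<^sup>2) \<le> \<gamma>\<^sup>2 * (\<Sum>t<N. (norm (w t))\<^sup>2)"
    and reach: "surj ((*v) G)"
  obtains P where "symmetric_matrix P" and "\<And>x. (norm (D *v x))\<^sup>2 \<le> x \<bullet> (P *v x)"
    and "\<And>x w. (F *v x + G *v w) \<bullet> (P *v (F *v x + G *v w)) + (norm (D *v x))\<^sup>2
      \<le> x \<bullet> (P *v x) + \<gamma>\<^sup>2 * (norm w)\<^sup>2"
proof -
  let ?E = "net_energy F G D \<gamma>"
  let ?V = "available_storage F G D \<gamma>"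
  obtain H where H: "G ** H = mat 1" using reach matrix_right_invertible_surjective by blast
  then have GH: "G *v (H *v x) = x" for x by (metis matrix_vector_mul_assoc matrix_vector_mul_lid)
  have E0: "?E N w 0 \<le> 0" for N w
    using gain[where N=N and w=w] by (simp add: net_energy_def sum_subtractf sum_distrib_left)
  have bound: "?E N w x \<le> \<gamma>\<^sup>2 * (norm (H *v x))\<^sup>2" for N w x
    \<comment> \<open>The input \<open>H x\<close> steers \<open>0\<close> to \<open>x\<close> in one step, before \<open>w\<close> is applied.\<close>
    using E0[of "Suc N" "case_nat (H *v x) w"] by (simp add: net_energy_shift GH)
  have bdd: "bdd_above (range (\<lambda>(N, w). ?E N w x))" for x
    using bound by (intro bdd_aboveI[of _ "\<gamma>\<^sup>2 * (norm (H *v x))\<^sup>2"]) auto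
  have upper: "?E N w x \<le> ?V x" for N w x
    unfolding available_storage_def using cSUP_upper[OF _ bdd[of x], of "(N, w)"] by simp
  have least: "?V x \<le> c" if "\<And>N w. ?E N w x \<le> c" for x c
    unfolding available_storage_def using that by (intro cSUP_least) auto
  have nonneg: "0 \<le> ?V x" for x using upper[of 0 "\<lambda>_. 0" x] by (simp add: net_energy_def)
  have scale_le: "c\<^sup>2 * ?V x \<le> ?V (c *\<^sub>R x)" for c x
  proof (cases "c = 0")
    case False
    have "?V x \<le> ?V (c *\<^sub>R x) / c\<^sup>2"
    proof (rule least)
      fix N w
      show "?E N w x \<le> ?V (c *\<^sub>R x) / c\<^sup>2"
        using upper[of N "\<lambda>t. c *\<^sub>R w t" "c *\<^sub>R x"] False
        by (simp add: net_energy_scale field_simps)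
    qed
    then show ?thesis using False by (simp add: field_simps)
  qed (simp add: nonneg)
  have scale: "?V (c *\<^sub>R x) = c\<^sup>2 * ?V x" for c x
  proof (cases "c = 0")
    case True
    have "?V 0 \<le> 0" using E0 by (rule least)
    then show ?thesis using True nonneg[of 0] by simp
  next
    case False
    have "(inverse c)\<^sup>2 * ?V (c *\<^sub>R x) \<le> ?V x" using scale_le[of "inverse c" "c *\<^sub>R x"] False by simp
    then have "?V (c *\<^sub>R x) \<le> c\<^sup>2 * ?V x" using False by (simp add: field_simps)
    then show ?thesis using scale_le[of c x] by simp
  qed
  have super: "2 * ?V x + 2 * ?V y \<le> ?V (x + y) + ?V (x - y)" for x y
  proof -
    have pair: "2 * ?E N w x + 2 * ?E N' w' y \<le> ?V (x + y) + ?V (x - y)" for N w N' w'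
    proof -
      let ?M = "max N N'"
      let ?w = "\<lambda>t. if t < N then w t else 0" and ?w' = "\<lambda>t. if t < N' then w' t else 0"
      have "2 * ?E N w x + 2 * ?E N' w' y \<le> 2 * ?E ?M ?w x + 2 * ?E ?M ?w' y"
        by (intro add_mono mult_left_mono net_energy_extend) auto
      also have "\<dots> \<le> ?V (x + y) + ?V (x - y)"
        unfolding net_energy_parallelogram[symmetric] by (intro add_mono upper)
      finally show ?thesis .
    qed
    have first: "?V x \<le> (?V (x + y) + ?V (x - y) - 2 * ?E N' w' y) / 2" for N' w'
    proof (rule least)
      show "?E N w x \<le> (?V (x + y) + ?V (x - y) - 2 * ?E N' w' y) / 2" for N w
        using pair[of N w N' w'] by simp
    qed
    have "?E N' w' y \<le> (?V (x + y) + ?V (x - y) - 2 * ?V x) / 2" for N' w'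
      using first[of N' w'] by simp
    then have "?V y \<le> (?V (x + y) + ?V (x - y) - 2 * ?V x) / 2" by (rule least)
    then show ?thesis by simp
  qed
  obtain h where h: "\<And>x. norm (H *v x) \<le> norm x * h"
    using bounded_linear.bounded[OF matrix_vector_mul_bounded_linear[of H]] by blast
  have "\<bar>?V x\<bar> \<le> (\<gamma>\<^sup>2 * h\<^sup>2) * (norm x)\<^sup>2" for x
  proof -
    have "?V x \<le> \<gamma>\<^sup>2 * (norm (H *v x))\<^sup>2" by (rule least) (rule bound)
    also have "\<dots> \<le> \<gamma>\<^sup>2 * (norm x * h)\<^sup>2"
      by (intro mult_left_mono power_mono h) auto
    finally show ?thesis using nonneg[of x] by (simp add: power_mult_distrib mult_ac)
  qed
  from quadratic_form_of_parallelogram[of ?V, OF scale super this]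
  obtain P where P: "symmetric_matrix P" "\<And>x. ?V x = x \<bullet> (P *v x)" by blast
  have step: "(norm (D *v x))\<^sup>2 - \<gamma>\<^sup>2 * (norm w)\<^sup>2 + ?V (F *v x + G *v w) \<le> ?V x" for x w
  proof -
    have "?E N w' (F *v x + G *v w) \<le> ?V x - ((norm (D *v x))\<^sup>2 - \<gamma>\<^sup>2 * (norm w)\<^sup>2)" for N w'
      using upper[of "Suc N" "case_nat w w'" x] by (simp add: net_energy_shift)
    then have "?V (F *v x + G *v w) \<le> ?V x - ((norm (D *v x))\<^sup>2 - \<gamma>\<^sup>2 * (norm w)\<^sup>2)"
      by (rule least)
    then show ?thesis by simp
  qed
  show thesis
  proof (rule that[OF P(1)])
    show "(norm (D *v x))\<^sup>2 \<le> x \<bullet> (P *v x)" for x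
      using step[of x 0] nonneg[of "F *v x + G *v 0"] by (simp add: P(2))
    show "(F *v x + G *v w) \<bullet> (P *v (F *v x + G *v w)) + (norm (D *v x))\<^sup>2
      \<le> x \<bullet> (P *v x) + \<gamma>\<^sup>2 * (norm w)\<^sup>2" for x w
      using step[of x w] by (simp add: P(2))
  qed
qed

section \<open>Dissipation inequalities bound the frequency response\<close>

text \<open>
  Here \<open>g\<close> stands for \<open>\<gamma>\<^sup>2\<close>, because the certificates are
  convex in the square of the gain.
\<close>

definition dissipative ::
    "real ^ 'x ^ 'x \<Rightarrow> real ^ 'w ^ 'x \<Rightarrow> real ^ 'x ^ 'z \<Rightarrow> real \<Rightarrow> real ^ 'x ^ 'x \<Rightarrow> bool"
  where "dissipative F G D g P \<longleftrightarrow>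
    (\<forall>x w. (F *v x + G *v w) \<bullet> (P *v (F *v x + G *v w)) + (norm (D *v x))\<^sup>2 \<le> x \<bullet> (P *v x) + g * (norm w)\<^sup>2)"

text \<open>For symmetric \<open>P\<close> this is the real number \<open>v\<^sup>H P v\<close>.\<close>

definition complex_quadratic :: "real ^ 'n ^ 'n \<Rightarrow> complex ^ 'n \<Rightarrow> real"
  where "complex_quadratic P v = Re_vector v \<bullet> (P *v Re_vector v) + Im_vector v \<bullet> (P *v Im_vector v)"

lemma complex_quadratic_smult: "complex_quadratic P (c *s v) = (cmod c)\<^sup>2 * complex_quadratic P v"
  unfolding complex_quadratic_def Re_Im_smult cmod_power2
  by (simp add: matrix_vector_mult_diff_distrib matrix_vector_right_distrib matrix_vector_mult_scaleR
      inner_diff_left inner_diff_right inner_add_left inner_add_right algebra_simps power2_eq_square)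

lemma complex_quadratic_pos:
  assumes "positive_definite P" "v \<noteq> 0" shows "0 < complex_quadratic P v"
proof -
  have "0 \<le> x \<bullet> (P *v x)" for x using assms(1) by (cases "x = 0") (auto simp: positive_definite_def less_imp_le)
  moreover have "Re_vector v \<noteq> 0 \<or> Im_vector v \<noteq> 0" using assms(2) Re_Im_eq_0 by blast
  ultimately show ?thesis using assms(1) unfolding complex_quadratic_def positive_definite_def
    by (metis add_nonneg_pos add_pos_nonneg)
qed

lemma dissipative_complex:
  assumes "dissipative F G D g P"
  shows "complex_quadratic P (complex_matrix F *v v + complex_matrix G *v u) + (norm (complex_matrix D *v v))\<^sup>2
    \<le> complex_quadratic P v + g * (norm u)\<^sup>2"
  using assms[unfolded dissipative_def, rule_format, of "Re_vector v" "Re_vector u"]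
    assms[unfolded dissipative_def, rule_format, of "Im_vector v" "Im_vector u"]
  unfolding complex_quadratic_def Re_Im_add Re_Im_complex_matrix norm_Re_Im[of "complex_matrix D *v v"] norm_Re_Im[of u]
  by (simp add: distrib_left)

text \<open>
  Lyapunov's argument at an eigenvector: its storage is multiplied by \<open>|l|\<^sup>2\<close>,
  and it has to decrease by the positive output energy.
\<close>

lemma dissipative_stable:
  fixes F :: "real ^ 'x ^ 'x"
  assumes dis: "dissipative F G D g P" and P: "positive_definite P" and D: "\<And>x. D *v x = 0 \<Longrightarrow> x = 0"
  shows "schur_stable F"
  unfolding schur_stable_def is_eigenvalue_def
proof (intro allI impI, elim exE conjE)
  fix l v assume v: "v \<noteq> 0" "complex_matrix F *v v = l *s v"
  have "complex_matrix D *v v \<noteq> 0"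
  proof
    assume "complex_matrix D *v v = 0"
    then have "D *v Re_vector v = 0" "D *v Im_vector v = 0"
      using Re_Im_complex_matrix[of D v] by (simp_all add: Re_vector_def Im_vector_def vec_eq_iff)
    then show False using D Re_Im_eq_0 v(1) by blast
  qed
  then have "0 < (norm (complex_matrix D *v v))\<^sup>2" by simp
  moreover have "(cmod l)\<^sup>2 * complex_quadratic P v + (norm (complex_matrix D *v v))\<^sup>2 \<le> complex_quadratic P v"
    using dissipative_complex[OF dis, of v 0] by (simp add: v(2) complex_quadratic_smult)
  ultimately have "(cmod l)\<^sup>2 * complex_quadratic P v < 1 * complex_quadratic P v" by linarith
  then have "(cmod l)\<^sup>2 < 1\<^sup>2" using complex_quadratic_pos[OF P v(1)] by (simp only: mult_less_cancel_right) auto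
  then show "cmod l < 1" by (rule power2_less_imp_less) simp
qed

text \<open>
  In steady state the storage is the same before and after a step, so the dissipation inequality
  leaves only output and input energy.
\<close>

lemma dissipative_gain:
  fixes F :: "real ^ 'x ^ 'x"
  assumes dis: "dissipative F G D (\<gamma>\<^sup>2) P" and stable: "schur_stable F" and \<gamma>: "0 \<le> \<gamma>"
  shows "hinf_norm F G D \<le> \<gamma>"
  unfolding hinf_norm_le_iff[OF stable \<gamma>]
proof (intro allI impI)
  fix e x v assume e: "cmod e = 1" and x: "e *s x - complex_matrix F *v x = complex_matrix G *v v"
  have "complex_matrix F *v x + complex_matrix G *v v = e *s x" using x by (simp add: algebra_simps)
  then have "(norm (complex_matrix D *v x))\<^sup>2 \<le> (\<gamma> * norm v)\<^sup>2"
    using dissipative_complex[OF dis, of x v] e by (simp add: complex_quadratic_smult power_mult_distrib)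
  then show "norm (complex_matrix D *v x) \<le> \<gamma> * norm v"
    by (rule power2_le_imp_le) (use \<gamma> in simp)
qed

section \<open>Positive definite matrices\<close>

lemma positive_definite_inverse:
  fixes M :: "real ^ 'n ^ 'n"
  assumes sym: "symmetric_matrix M" and pd: "positive_definite M"
  shows "M ** matrix_inv M = mat 1" "matrix_inv M ** M = mat 1"
    and "symmetric_matrix (matrix_inv M)" "positive_definite (matrix_inv M)"
proof -
  have "invertible M"
    unfolding invertible_kernel using pd unfolding positive_definite_def by (metis inner_zero_right less_irrefl)
  note inv = matrix_inv_works[OF this]
  then show "M ** matrix_inv M = mat 1" "matrix_inv M ** M = mat 1" .
  have M: "M *v (matrix_inv M *v x) = x" for x
    by (metis inv(1) matrix_vector_mul_assoc matrix_vector_mul_lid)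
  have "(matrix_inv M *v x) \<bullet> y = x \<bullet> (matrix_inv M *v y)" for x y
    by (metis M symmetric_matrix_inner[OF sym])
  then show "symmetric_matrix (matrix_inv M)" by (rule symmetric_matrixI)
  show "positive_definite (matrix_inv M)"
    unfolding positive_definite_def
  proof (intro allI impI)
    fix x :: "real ^ 'n" assume "x \<noteq> 0"
    then have "matrix_inv M *v x \<noteq> 0" using M[of x] by (metis matrix_vector_mult_0_right)
    then have "0 < (matrix_inv M *v x) \<bullet> (M *v (matrix_inv M *v x))"
      using pd unfolding positive_definite_def by blast
    then show "0 < x \<bullet> (matrix_inv M *v x)" by (simp add: M inner_commute)
  qed
qed

lemma positive_definite_coercive:
  fixes M :: "real ^ 'n ^ 'n"
  assumes sym: "symmetric_matrix M" and pd: "positive_definite M"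
  obtains m where "0 < m" "\<And>x. m * (norm x)\<^sup>2 \<le> x \<bullet> (M *v x)"
proof -
  have neg: "(- M) *v x = - (M *v x)" for x
    by (simp add: vec_eq_iff matrix_vector_mult_def sum_negf)
  have adj: "((- M) *v x) \<bullet> y = x \<bullet> ((- M) *v y)" for x y
    by (simp add: neg symmetric_matrix_inner[OF sym])
  have "(UNIV :: (real ^ 'n) set) \<noteq> {0}"
    by (metis UNIV_I axis_eq_0_iff singletonD zero_neq_one)
  then obtain v l where v: "norm v = 1" "(- M) *v v = l *\<^sub>R v"
      and max: "\<And>x. x \<bullet> ((- M) *v x) \<le> l * (x \<bullet> x)"
    using self_adjoint_extremal_eigenvector[of "(*v) (- M)" UNIV] adj by auto
  have "v \<bullet> (M *v v) = - l"
    using arg_cong[OF v(2), of "\<lambda>y. v \<bullet> y"] v(1) by (simp add: neg norm_eq_1)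
  moreover have "0 < v \<bullet> (M *v v)"
    using pd v(1) unfolding positive_definite_def by (metis norm_zero zero_neq_one)
  ultimately have "0 < - l" by simp
  moreover have "- l * (norm x)\<^sup>2 \<le> x \<bullet> (M *v x)" for x
    using max[of x] by (simp add: neg power2_norm_eq_inner)
  ultimately show thesis by (rule that)
qed

lemma matrix_mult_diff_rdistrib: "(M - N) ** E = M ** E - N ** E" for M N :: "real ^ 'n ^ 'm"
  by (simp add: matrix_eq matrix_vector_mult_diff_rdistrib matrix_vector_mul_assoc[symmetric])

text \<open>
  Multiplication by \<open>X\<close> acts on the rows of \<open>E\<close>, and each row grows by
  the factor \<open>m\<close> at least.
\<close>

lemma coercive_product_norm:
  fixes E :: "real ^ 'n ^ 'm" and X :: "real ^ 'n ^ 'n"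
  assumes sym: "symmetric_matrix X" and m: "0 < m" and coer: "\<And>x. m * (norm x)\<^sup>2 \<le> x \<bullet> (X *v x)"
  shows "m * norm E \<le> norm (E ** X)"
proof -
  have row: "(E ** X) $ i = X *v (E $ i)" for i
  proof -
    have "(E ** X) $ i = (E $ i) v* X"
      by (simp add: vec_eq_iff matrix_matrix_mult_def vector_matrix_mult_def mult.commute)
    then show ?thesis using sym by (metis symmetric_matrix_def transpose_matrix_vector)
  qed
  have "m * norm x \<le> norm (X *v x)" for x
  proof (cases "x = 0")
    case False
    have "m * (norm x)\<^sup>2 \<le> norm x * norm (X *v x)"
      using coer norm_cauchy_schwarz by (rule order_trans)
    then have "norm x * (m * norm x) \<le> norm x * norm (X *v x)"
      by (simp add: power2_eq_square mult_ac)
    then show ?thesis using False by simp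
  qed simp
  then have "norm (m *\<^sub>R E) \<le> norm (E ** X)"
    using m by (intro norm_le_componentwise_cart[of "m *\<^sub>R E" "E ** X"] allI) (simp only: row, simp)
  then show ?thesis using m by simp
qed

section \<open>The convex lift of the certificates\<close>

text \<open>
  Put \<open>x = X \<xi>\<close> and \<open>K x = Y \<xi>\<close> in the dissipation inequality,
  with \<open>P = X\<^sup>-\<^sup>1\<close>. The term \<open>a \<bullet> X\<^sup>-\<^sup>1
  a\<close> of the next state \<open>a\<close> is the supremum of \<open>2 p \<bullet> a - p
  \<bullet> X p\<close> over \<open>p\<close>; quantifying over \<open>p\<close> makes the
  condition affine in \<open>(X, Y, g)\<close> apart from two convex squares.
\<close>

definition lifted_certificate ::
    "real ^ 'x ^ 'x \<Rightarrow> real ^ 'u ^ 'x \<Rightarrow> real ^ 'w ^ 'x \<Rightarrow> real ^ 'x ^ 'x \<Rightarrow> real ^ 'u ^ 'v \<Rightarrow>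
     real \<Rightarrow> real ^ 'x ^ 'x \<Rightarrow> real ^ 'x ^ 'u \<Rightarrow> bool"
  where "lifted_certificate A B Bw S T g X Y \<longleftrightarrow>
    (\<forall>\<xi> w p. 2 * (p \<bullet> (A *v (X *v \<xi>) + B *v (Y *v \<xi>) + Bw *v w)) - p \<bullet> (X *v p)
      + (norm (S *v (X *v \<xi>)))\<^sup>2 + (norm (T *v (Y *v \<xi>)))\<^sup>2 \<le> \<xi> \<bullet> (X *v \<xi>) + g * (norm w)\<^sup>2)"

lemma norm_square_convex:
  fixes a b :: "'a::real_inner"
  assumes "0 \<le> t" "t \<le> 1"
  shows "(norm ((1 - t) *\<^sub>R a + t *\<^sub>R b))\<^sup>2 \<le> (1 - t) * (norm a)\<^sup>2 + t * (norm b)\<^sup>2"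
proof -
  have "(1 - t) * (norm a)\<^sup>2 + t * (norm b)\<^sup>2 - (norm ((1 - t) *\<^sub>R a + t *\<^sub>R b))\<^sup>2
      = (t * (1 - t)) * (norm (a - b))\<^sup>2"
    by (simp add: power2_norm_eq_inner inner_add_left inner_add_right inner_diff_left inner_diff_right
        inner_commute algebra_simps)
  also have "\<dots> \<ge> 0" using assms by simp
  finally show ?thesis by simp
qed

lemma lifted_certificate_convex:
  assumes c0: "lifted_certificate A B Bw S T g0 X0 Y0" and c1: "lifted_certificate A B Bw S T g1 X1 Y1"
    and t: "0 \<le> t" "t \<le> 1"
  shows "lifted_certificate A B Bw S T ((1 - t) * g0 + t * g1)
    ((1 - t) *\<^sub>R X0 + t *\<^sub>R X1) ((1 - t) *\<^sub>R Y0 + t *\<^sub>R Y1)"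
  unfolding lifted_certificate_def
proof (intro allI)
  fix \<xi> w p
  have comb: "((1 - t) *\<^sub>R M + t *\<^sub>R N) *v \<xi> = (1 - t) *\<^sub>R (M *v \<xi>) + t *\<^sub>R (N *v \<xi>)"
    for M N :: "real ^ 'p ^ 'q" and \<xi>
    by (simp add: matrix_vector_mult_add_rdistrib scaleR_matrix_vector_assoc)
  let ?q = "\<lambda>X Y g. 2 * (p \<bullet> (A *v (X *v \<xi>) + B *v (Y *v \<xi>) + Bw *v w)) - p \<bullet> (X *v p)
      - \<xi> \<bullet> (X *v \<xi>) - g * (norm w)\<^sup>2"
  let ?n = "\<lambda>X Y. (norm (S *v (X *v \<xi>)))\<^sup>2 + (norm (T *v (Y *v \<xi>)))\<^sup>2"
  let ?X = "(1 - t) *\<^sub>R X0 + t *\<^sub>R X1" and ?Y = "(1 - t) *\<^sub>R Y0 + t *\<^sub>R Y1"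
  let ?g = "(1 - t) * g0 + t * g1"
  have q: "?q ?X ?Y ?g = (1 - t) * ?q X0 Y0 g0 + t * ?q X1 Y1 g1"
    unfolding comb
    by (simp add: matrix_vector_right_distrib matrix_vector_mult_scaleR inner_add_right algebra_simps)
  have "?n ?X ?Y \<le> ((1 - t) * (norm (S *v (X0 *v \<xi>)))\<^sup>2 + t * (norm (S *v (X1 *v \<xi>)))\<^sup>2)
      + ((1 - t) * (norm (T *v (Y0 *v \<xi>)))\<^sup>2 + t * (norm (T *v (Y1 *v \<xi>)))\<^sup>2)"
    unfolding comb matrix_vector_right_distrib matrix_vector_mult_scaleR
    by (intro add_mono norm_square_convex t)
  also have "\<dots> = (1 - t) * ?n X0 Y0 + t * ?n X1 Y1" by (simp add: algebra_simps)
  finally have "?q ?X ?Y ?g + ?n ?X ?Y \<le> (1 - t) * (?q X0 Y0 g0 + ?n X0 Y0) + t * (?q X1 Y1 g1 + ?n X1 Y1)"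
    unfolding q by (simp add: algebra_simps)
  also have "\<dots> \<le> 0"
  proof -
    have neg: "?q X0 Y0 g0 + ?n X0 Y0 \<le> 0" "?q X1 Y1 g1 + ?n X1 Y1 \<le> 0"
      using c0[unfolded lifted_certificate_def, rule_format, of p \<xi> w]
        c1[unfolded lifted_certificate_def, rule_format, of p \<xi> w] by linarith+
    show ?thesis
      by (intro add_nonpos_nonpos mult_nonneg_nonpos[OF _ neg(1)] mult_nonneg_nonpos[OF _ neg(2)])
        (use t in auto)
  qed
  finally show "2 * (p \<bullet> (A *v (?X *v \<xi>) + B *v (?Y *v \<xi>) + Bw *v w)) - p \<bullet> (?X *v p)
      + (norm (S *v (?X *v \<xi>)))\<^sup>2 + (norm (T *v (?Y *v \<xi>)))\<^sup>2 \<le> \<xi> \<bullet> (?X *v \<xi>) + ?g * (norm w)\<^sup>2"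
    by linarith
qed

lemma stack_rows_norm:
  fixes M :: "real ^ 'n ^ 'm" and N :: "real ^ 'n ^ 'k"
  shows "(norm (stack_rows M N *v x))\<^sup>2 = (norm (M *v x))\<^sup>2 + (norm (N *v x))\<^sup>2"
proof -
  have sq: "(norm v)\<^sup>2 = (\<Sum>i\<in>UNIV. (v $ i)\<^sup>2)" for v :: "real ^ 'p"
    by (simp add: norm_vec_def L2_set_def sum_nonneg)
  show ?thesis
    unfolding sq UNIV_Plus_UNIV[symmetric]
    by (subst sum.Plus) (simp_all add: stack_rows_def matrix_vector_mult_def)
qed

text \<open>
  Completing the square, \<open>(p - P a) \<bullet> X (p - P a) \<ge> 0\<close>, bounds the terms
  with \<open>p\<close> by \<open>a \<bullet> P a\<close>.
\<close>

lemma dissipative_imp_lifted: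
  fixes A :: "real ^ 'x ^ 'x" and B :: "real ^ 'u ^ 'x"
  assumes dis: "dissipative (A + B ** K) Bw (stack_rows S (T ** K)) g P"
    and P: "symmetric_matrix P" "positive_definite P"
  shows "lifted_certificate A B Bw S T g (matrix_inv P) (K ** matrix_inv P)"
  unfolding lifted_certificate_def
proof (intro allI)
  fix \<xi> w p
  let ?X = "matrix_inv P"
  define x where "x = ?X *v \<xi>"
  define a where "a = A *v x + B *v (K *v x) + Bw *v w"
  note inv = positive_definite_inverse[OF P]
  have PX: "P *v (?X *v y) = y" and XP: "?X *v (P *v y) = y" for y
    by (metis inv(1) matrix_vector_mul_assoc matrix_vector_mul_lid,
        metis inv(2) matrix_vector_mul_assoc matrix_vector_mul_lid)
  have "0 \<le> (p - P *v a) \<bullet> (?X *v (p - P *v a))"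
    using inv(4) unfolding positive_definite_def by (metis inner_zero_left less_eq_real_def)
  also have "\<dots> = p \<bullet> (?X *v p) - 2 * (p \<bullet> a) + a \<bullet> (P *v a)"
    using symmetric_matrix_inner[OF inv(3), of "P *v a" p]
    by (simp add: matrix_vector_mult_diff_distrib XP inner_diff_left inner_diff_right inner_commute)
  finally have "2 * (p \<bullet> a) - p \<bullet> (?X *v p) \<le> a \<bullet> (P *v a)" by simp
  moreover have "a \<bullet> (P *v a) + (norm (S *v x))\<^sup>2 + (norm (T *v (K *v x)))\<^sup>2 \<le> x \<bullet> (P *v x) + g * (norm w)\<^sup>2"
    using dis[unfolded dissipative_def, rule_format, of x w]
    by (simp add: a_def stack_rows_norm matrix_vector_mult_add_rdistrib matrix_vector_mul_assoc[symmetric])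
  moreover have "x \<bullet> (P *v x) = \<xi> \<bullet> (?X *v \<xi>)" by (simp add: x_def PX inner_commute)
  ultimately show "2 * (p \<bullet> (A *v (?X *v \<xi>) + B *v ((K ** ?X) *v \<xi>) + Bw *v w)) - p \<bullet> (?X *v p)
      + (norm (S *v (?X *v \<xi>)))\<^sup>2 + (norm (T *v ((K ** ?X) *v \<xi>)))\<^sup>2 \<le> \<xi> \<bullet> (?X *v \<xi>) + g * (norm w)\<^sup>2"
    by (simp add: a_def x_def matrix_vector_mul_assoc[symmetric])
qed

text \<open>The supremum over \<open>p\<close> is attained at \<open>p = P a\<close>.\<close>

lemma lifted_imp_dissipative:
  fixes A :: "real ^ 'x ^ 'x" and B :: "real ^ 'u ^ 'x"
  assumes cert: "lifted_certificate A B Bw S T g X Y"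
    and X: "symmetric_matrix X" "positive_definite X"
  shows "dissipative (A + B ** (Y ** matrix_inv X)) Bw (stack_rows S (T ** (Y ** matrix_inv X))) g (matrix_inv X)"
  unfolding dissipative_def
proof (intro allI)
  fix x w
  let ?P = "matrix_inv X" and ?K = "Y ** matrix_inv X"
  let ?a = "(A + B ** ?K) *v x + Bw *v w"
  note inv = positive_definite_inverse[OF X]
  have XP: "X *v (?P *v y) = y" for y
    by (metis inv(1) matrix_vector_mul_assoc matrix_vector_mul_lid)
  show "?a \<bullet> (?P *v ?a) + (norm (stack_rows S (T ** ?K) *v x))\<^sup>2 \<le> x \<bullet> (?P *v x) + g * (norm w)\<^sup>2"
    using cert[unfolded lifted_certificate_def, rule_format, of "?P *v ?a" "?P *v x" w]
    by (simp add: XP stack_rows_norm matrix_vector_mult_add_rdistrib matrix_vector_mul_assoc[symmetric]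
        inner_commute)
qed

section \<open>Descent towards a better gain\<close>

text \<open>
  The gain itself, and not only larger numbers, is certified. The injectivity of \<open>S\<close>
  makes the available storage positive definite.
\<close>

lemma stabilizing_gain_certificate:
  fixes A :: "real ^ 'x ^ 'x" and B :: "real ^ 'u ^ 'x" and Bw :: "real ^ 'w ^ 'x"
  assumes reach: "surj ((*v) Bw)" and S: "\<And>x. S *v x = 0 \<Longrightarrow> x = 0"
    and stable: "schur_stable (A + B ** K)"
  obtains X where "symmetric_matrix X" "positive_definite X"
    "lifted_certificate A B Bw S T ((hinf_norm (A + B ** K) Bw (stack_rows S (T ** K)))\<^sup>2) X (K ** X)"
proof -
  let ?D = "stack_rows S (T ** K)"
  let ?\<gamma> = "hinf_norm (A + B ** K) Bw ?D"
  obtain P where P: "symmetric_matrix P" "\<And>x. (norm (?D *v x))\<^sup>2 \<le> x \<bullet> (P *v x)"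
    "\<And>x w. ((A + B ** K) *v x + Bw *v w) \<bullet> (P *v ((A + B ** K) *v x + Bw *v w)) + (norm (?D *v x))\<^sup>2
      \<le> x \<bullet> (P *v x) + ?\<gamma>\<^sup>2 * (norm w)\<^sup>2"
    using storage_certificate[OF zero_state_gain[OF stable order_refl] reach] by blast
  have pd: "positive_definite P"
    unfolding positive_definite_def
  proof (intro allI impI)
    fix x :: "real ^ 'x" assume "x \<noteq> 0"
    then have "S *v x \<noteq> 0" using S by blast
    then have "0 < (norm (?D *v x))\<^sup>2" by (simp add: stack_rows_norm add_pos_nonneg)
    also have "\<dots> \<le> x \<bullet> (P *v x)" by (rule P(2))
    finally show "0 < x \<bullet> (P *v x)" .
  qed
  have "dissipative (A + B ** K) Bw ?D (?\<gamma>\<^sup>2) P" unfolding dissipative_def using P(3) by blast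
  from dissipative_imp_lifted[OF this P(1) pd] show thesis
    using positive_definite_inverse[OF P(1) pd] by (intro that[of "matrix_inv P"])
qed

text \<open>
  On the segment between the two certificates the squared bound is \<open>(1 - t) (J K0)\<^sup>2
  + t (J K1)\<^sup>2\<close>, whose root lies below its tangent \<open>J K0 - \<delta> t\<close>
  at \<open>t = 0\<close>. The distance of the gains is linear in \<open>t\<close> because
  \<open>(K - K0) X = t (K1 - K0) X1\<close> and \<open>X\<close> is coercive uniformly in
  \<open>t\<close>.
\<close>

lemma descent_towards_better_gain:
  fixes A :: "real ^ 'x ^ 'x" and B :: "real ^ 'u ^ 'x" and Bw :: "real ^ 'w ^ 'x"
    and K0 :: "real ^ 'x ^ 'u" and S :: "real ^ 'x ^ 'x" and T :: "real ^ 'u ^ 'u"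
  defines "J \<equiv> \<lambda>K. hinf_norm (A + B ** K) Bw (stack_rows S (T ** K))"
  assumes reach: "surj ((*v) Bw)" and S: "\<And>x. S *v x = 0 \<Longrightarrow> x = 0"
    and stable0: "schur_stable (A + B ** K0)" and stable1: "schur_stable (A + B ** K1)"
    and better: "J K1 < J K0"
  obtains c \<delta> where "0 < c" "0 < \<delta>"
    "\<And>t. 0 \<le> t \<Longrightarrow> t \<le> 1 \<Longrightarrow> \<exists>K. schur_stable (A + B ** K) \<and> norm (K - K0) \<le> c * t \<and> J K \<le> J K0 - \<delta> * t"
proof -
  obtain X0 where X0: "symmetric_matrix X0" "positive_definite X0"
      and cert0: "lifted_certificate A B Bw S T ((J K0)\<^sup>2) X0 (K0 ** X0)"
    using stabilizing_gain_certificate[OF reach S stable0, where T=T] unfolding J_def by blast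
  obtain X1 where X1: "symmetric_matrix X1" "positive_definite X1"
      and cert1: "lifted_certificate A B Bw S T ((J K1)\<^sup>2) X1 (K1 ** X1)"
    using stabilizing_gain_certificate[OF reach S stable1, where T=T] unfolding J_def by blast
  obtain m0 where m0: "0 < m0" "\<And>x. m0 * (norm x)\<^sup>2 \<le> x \<bullet> (X0 *v x)"
    using positive_definite_coercive[OF X0] by blast
  obtain m1 where m1: "0 < m1" "\<And>x. m1 * (norm x)\<^sup>2 \<le> x \<bullet> (X1 *v x)"
    using positive_definite_coercive[OF X1] by blast
  define m where "m = min m0 m1"
  have m: "0 < m" using m0 m1 by (simp add: m_def)
  have J1: "0 \<le> J K1" unfolding J_def by (rule hinf_norm_nonneg[OF stable1])
  then have J0: "0 < J K0" using better by simp
  define \<delta> where "\<delta> = ((J K0)\<^sup>2 - (J K1)\<^sup>2) / (2 * J K0)"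
  define E where "E = (K1 - K0) ** X1"
  define c where "c = (norm E + 1) / m"
  have "(J K1)\<^sup>2 < (J K0)\<^sup>2" using better J1 by (simp add: power_strict_mono)
  then have \<delta>: "0 < \<delta>" using J0 by (simp add: \<delta>_def)
  have c: "0 < c" using m by (simp add: c_def add_nonneg_pos)
  have "\<exists>K. schur_stable (A + B ** K) \<and> norm (K - K0) \<le> c * t \<and> J K \<le> J K0 - \<delta> * t"
    if t: "0 \<le> t" "t \<le> 1" for t
  proof -
    define X where "X = (1 - t) *\<^sub>R X0 + t *\<^sub>R X1"
    define Y where "Y = (1 - t) *\<^sub>R (K0 ** X0) + t *\<^sub>R (K1 ** X1)"
    define K where "K = Y ** matrix_inv X"
    define \<gamma> where "\<gamma> = sqrt ((1 - t) * (J K0)\<^sup>2 + t * (J K1)\<^sup>2)"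
    have g: "\<gamma>\<^sup>2 = (1 - t) * (J K0)\<^sup>2 + t * (J K1)\<^sup>2" "0 \<le> \<gamma>"
      using t by (simp_all add: \<gamma>_def)
    have Xx: "X *v x = (1 - t) *\<^sub>R (X0 *v x) + t *\<^sub>R (X1 *v x)" for x
      by (simp add: X_def matrix_vector_mult_add_rdistrib scaleR_matrix_vector_assoc)
    have symX: "symmetric_matrix X"
      by (rule symmetric_matrixI)
        (simp add: Xx inner_add_left inner_add_right symmetric_matrix_inner[OF X0(1)] symmetric_matrix_inner[OF X1(1)])
    have coer: "m * (norm x)\<^sup>2 \<le> x \<bullet> (X *v x)" for x
    proof -
      have "m * (norm x)\<^sup>2 = (1 - t) * (m * (norm x)\<^sup>2) + t * (m * (norm x)\<^sup>2)"
        by (simp add: algebra_simps)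
      also have "\<dots> \<le> (1 - t) * (x \<bullet> (X0 *v x)) + t * (x \<bullet> (X1 *v x))"
        using t by (intro add_mono mult_left_mono order_trans[OF _ m0(2)] order_trans[OF _ m1(2)] mult_right_mono)
          (auto simp: m_def)
      finally show ?thesis by (simp add: Xx inner_add_right)
    qed
    have pdX: "positive_definite X"
      unfolding positive_definite_def using coer m by (metis less_le_trans mult_pos_pos zero_less_norm_iff zero_less_power)
    note inv = positive_definite_inverse[OF symX pdX]
    have "lifted_certificate A B Bw S T (\<gamma>\<^sup>2) X Y"
      unfolding g X_def Y_def by (rule lifted_certificate_convex[OF cert0 cert1 t])
    then have dis: "dissipative (A + B ** K) Bw (stack_rows S (T ** K)) (\<gamma>\<^sup>2) (matrix_inv X)"
      unfolding K_def by (rule lifted_imp_dissipative[OF _ symX pdX])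
    have "x = 0" if "stack_rows S (T ** K) *v x = 0" for x
      using stack_rows_norm[of S "T ** K" x] that S[of x] by (simp add: add_nonneg_eq_0_iff)
    then have stable: "schur_stable (A + B ** K)"
      by (rule dissipative_stable[OF dis inv(4)])
    have "J K \<le> \<gamma>" unfolding J_def by (rule dissipative_gain[OF dis stable g(2)])
    also have "\<gamma> \<le> J K0 - \<delta> * t"
    proof (rule power2_le_imp_le)
      have "\<delta> * t \<le> \<delta>" using \<delta> t by simp
      also have "\<delta> \<le> J K0 / 2"
        using J0 by (simp add: \<delta>_def field_simps power2_eq_square)
      finally show "0 \<le> J K0 - \<delta> * t" using J0 by simp
      have "\<gamma>\<^sup>2 = (J K0)\<^sup>2 - 2 * J K0 * (\<delta> * t)"
        using J0 by (simp add: g \<delta>_def field_simps)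
      also have "\<dots> \<le> (J K0 - \<delta> * t)\<^sup>2" by (simp add: power2_diff)
      finally show "\<gamma>\<^sup>2 \<le> (J K0 - \<delta> * t)\<^sup>2" .
    qed
    finally have "J K \<le> J K0 - \<delta> * t" .
    moreover have "norm (K - K0) \<le> c * t"
    proof -
      have "K ** X = Y" using inv(2) by (simp add: K_def matrix_mul_assoc[symmetric])
      moreover have "K0 ** X = (1 - t) *\<^sub>R (K0 ** X0) + t *\<^sub>R (K0 ** X1)"
        by (simp add: X_def matrix_add_ldistrib matrix_scalar_ac scalar_matrix_assoc)
      ultimately have "(K - K0) ** X = t *\<^sub>R E"
        by (simp add: E_def Y_def matrix_mult_diff_rdistrib scaleR_diff_right)
      then have "m * norm (K - K0) \<le> t * norm E"
        using coercive_product_norm[OF symX m coer, of "K - K0"] t by simp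
      also have "\<dots> \<le> t * (norm E + 1)" using t by (intro mult_left_mono) auto
      finally show ?thesis using m by (simp add: c_def field_simps)
    qed
    ultimately show ?thesis using stable by blast
  qed
  then show thesis using c \<delta> by (intro that)
qed

section \<open>Stationary gains are optimal\<close>

lemma zero_subgradientI:
  assumes "\<And>y. y \<in> S \<Longrightarrow> f x \<le> f y"
  shows "0 \<in> frechet_subdifferential S f x"
proof -
  have "eventually (\<lambda>y. 0 \<le> ereal ((f y - f x - 0 \<bullet> (y - x)) / norm (y - x))) (at x within S)"
    unfolding eventually_at by (intro exI[of _ 1]) (use assms in auto)
  then show ?thesis unfolding frechet_subdifferential_def by (simp add: Liminf_bounded)
qed

text \<open>
  At the points of the curve the difference quotient is at most \<open>- \<delta> / c\<close>,
  however close they are to \<open>x\<close>.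
\<close>

lemma zero_subgradient_no_linear_descent:
  assumes sub: "0 \<in> frechet_subdifferential S f x"
    and c: "0 < c" and \<delta>: "0 < \<delta>"
    and curve: "\<And>t. 0 \<le> t \<Longrightarrow> t \<le> 1 \<Longrightarrow> \<exists>y\<in>S. norm (y - x) \<le> c * t \<and> f y \<le> f x - \<delta> * t"
  shows False
proof -
  have "0 \<le> Liminf (at x within S) (\<lambda>y. ereal ((f y - f x - 0 \<bullet> (y - x)) / norm (y - x)))"
    using sub unfolding frechet_subdifferential_def by blast
  moreover have "ereal (- \<delta> / c) < 0" using c \<delta> by simp
  ultimately have "eventually (\<lambda>y. ereal (- \<delta> / c) < ereal ((f y - f x - 0 \<bullet> (y - x)) / norm (y - x))) (at x within S)"
    unfolding le_Liminf_iff by blast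
  then obtain d where d: "0 < d"
    "\<And>y. y \<in> S \<Longrightarrow> y \<noteq> x \<Longrightarrow> dist y x < d \<Longrightarrow> - \<delta> / c < (f y - f x) / norm (y - x)"
    unfolding eventually_at by auto
  define t where "t = min 1 (d / (2 * c))"
  have t: "0 < t" "t \<le> 1" using d c by (simp_all add: t_def)
  obtain y where y: "y \<in> S" "norm (y - x) \<le> c * t" "f y \<le> f x - \<delta> * t"
    using curve[of t] t by auto
  have "f y < f x" using y(3) t(1) \<delta> by (smt (verit) mult_pos_pos)
  then have "y \<noteq> x" by auto
  have "c * t \<le> d / 2" using c by (simp add: t_def min_def field_simps)
  then have "dist y x < d" using y(2) d(1) by (simp add: dist_norm)
  with d(2)[OF y(1) \<open>y \<noteq> x\<close>] have "- \<delta> / c < (f y - f x) / norm (y - x)" by simp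
  then have "- \<delta> / c * norm (y - x) < f y - f x"
    using \<open>y \<noteq> x\<close> by (simp add: pos_less_divide_eq)
  moreover have "- (\<delta> * t) \<le> - \<delta> / c * norm (y - x)"
  proof -
    have "\<delta> * norm (y - x) \<le> \<delta> * (c * t)" using y(2) \<delta> by (intro mult_left_mono) auto
    then show ?thesis using c by (simp add: field_simps)
  qed
  ultimately show False using y(3) by simp
qed

theorem corollary2:
  fixes A :: "real ^ 'x ^ 'x"
    and B :: "real ^ 'u ^ 'x"
    and Bw :: "real ^ 'w ^ 'x"
    and C :: "real ^ 'x ^ 'x"
    and Q :: "real ^ 'x ^ 'x"
    and R :: "real ^ 'u ^ 'u"
    and K :: "real ^ 'x ^ 'u"
  assumes "stabilizable A B"
    and "full_row_rank Bw"
    and "full_row_rank C"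
    and "symmetric_matrix Q" and "positive_definite Q"
    and "symmetric_matrix R" and "positive_definite R"
    and "stabilizing_gains A B C \<noteq> {}"
    and "C = mat 1"
    and "K \<in> stabilizing_gains A B C"
  shows "0 \<in> frechet_subdifferential (stabilizing_gains A B C) (hinf_cost A B Bw C Q R) K
    \<longleftrightarrow> is_arg_min (hinf_cost A B Bw C Q R) (\<lambda>K'. K' \<in> stabilizing_gains A B C) K"
proof -
  let ?S = "matrix_sqrt Q" and ?T = "matrix_sqrt R"
  have gains: "K' \<in> stabilizing_gains A B C \<longleftrightarrow> schur_stable (A + B ** K')" for K'
    by (simp add: stabilizing_gains_def \<open>C = mat 1\<close>)
  have cost: "hinf_cost A B Bw C Q R K' = hinf_norm (A + B ** K') Bw (stack_rows ?S (?T ** K'))" for K'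
    by (simp add: hinf_cost_def hinf_norm_def transfer_zw_def frequency_response_def \<open>C = mat 1\<close>)
  have reach: "surj ((*v) Bw)"
    using \<open>full_row_rank Bw\<close> by (simp add: full_row_rank_def full_rank_surjective)
  have S: "x = 0" if "?S *v x = 0" for x
  proof (rule ccontr)
    assume "x \<noteq> 0"
    have "positive_semidefinite Q"
      unfolding positive_semidefinite_def using \<open>positive_definite Q\<close>
      by (metis inner_zero_left less_eq_real_def positive_definite_def)
    then have "Q *v x = ?S *v (?S *v x)"
      using matrix_sqrt_square[OF \<open>symmetric_matrix Q\<close>] by (metis matrix_vector_mul_assoc)
    then show False using that \<open>x \<noteq> 0\<close> \<open>positive_definite Q\<close> by (force simp: positive_definite_def)
  qed
  show ?thesis
  proof
    assume sub: "0 \<in> frechet_subdifferential (stabilizing_gains A B C) (hinf_cost A B Bw C Q R) K"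
    have "\<not> hinf_cost A B Bw C Q R K1 < hinf_cost A B Bw C Q R K"
      if K1: "K1 \<in> stabilizing_gains A B C" for K1
    proof
      assume better: "hinf_cost A B Bw C Q R K1 < hinf_cost A B Bw C Q R K"
      have "schur_stable (A + B ** K)" "schur_stable (A + B ** K1)"
        using K1 \<open>K \<in> stabilizing_gains A B C\<close> gains by blast+
      from descent_towards_better_gain[OF reach S this better[unfolded cost]]
      obtain c \<delta> where c: "0 < c" "0 < \<delta>" and curve: "\<And>t. 0 \<le> t \<Longrightarrow> t \<le> 1 \<Longrightarrow>
          \<exists>K'. schur_stable (A + B ** K') \<and> norm (K' - K) \<le> c * t
            \<and> hinf_cost A B Bw C Q R K' \<le> hinf_cost A B Bw C Q R K - \<delta> * t"
        unfolding cost by blast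
      have "\<exists>K'\<in>stabilizing_gains A B C. norm (K' - K) \<le> c * t
            \<and> hinf_cost A B Bw C Q R K' \<le> hinf_cost A B Bw C Q R K - \<delta> * t"
        if "0 \<le> t" "t \<le> 1" for t
        using curve[OF that] gains by blast
      then show False by (rule zero_subgradient_no_linear_descent[OF sub c])
    qed
    then show "is_arg_min (hinf_cost A B Bw C Q R) (\<lambda>K'. K' \<in> stabilizing_gains A B C) K"
      unfolding is_arg_min_def using \<open>K \<in> stabilizing_gains A B C\<close> by blast
  next
    assume "is_arg_min (hinf_cost A B Bw C Q R) (\<lambda>K'. K' \<in> stabilizing_gains A B C) K"
    then show "0 \<in> frechet_subdifferential (stabilizing_gains A B C) (hinf_cost A B Bw C Q R) K"
      by (intro zero_subgradientI) (auto simp: is_arg_min_def not_less)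
  qed
qed

end
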